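(* Let $\alpha\in(0,2)$, let $X=(x_{ij})$ be the $N\times n$ heavy-tailed random matrix described in the context, with tail exponent $\alpha$, and suppose that $x_{11}$ is symmetrically distributed. Let $\mathfrak u$ be the bottom singular vector of $X$. Then for any arbitrarily small $\delta>0$ there is a (random, depending on $\mathfrak u$) subset $\hat J\subset[n]$ such that $|\hat J|=n-o(n)$ but $\|\mathfrak u_{\hat J}\|_2<\sqrt\delta$ with high probability.
   Context: Model: $\mathsf a>1$ is a constant, $N=\lceil \mathsf a n\rceil$, and $X=(x_{ij})$ is an $N\times n$ real random matrix with i.i.d. entries whose law does not depend on $n$ and satisfies, for some constants $\alpha,C_\ell,C_u,T_0>0$, $C_\ell t^{-\alpha}\le \mathbb P\{|x_{11}|>t\}\le C_u t^{-\alpha}$ for all $t\ge T_0$. "Symmetrically distributed" means $x_{11}$ and $-x_{11}$ have the same law. The bottom singular vector $\mathfrak u$ is the unit (in $\ell^2$) right singular vector of $X$ corresponding to the smallest singular value $s_{\min}(X)=\inf_{\|u\|_2=1}\|Xu\|_2$. Notation: $[n]=\{1,\dots,n\}$; for $x\in\mathbb R^n$ and $I\subseteq[n]$, $x_I\in\mathbb R^{|I|}$ is obtained by deleting the components with indices in $I^c$. Asymptotics are as $n\to\infty$ with $\mathsf a$ and the law of $x_{11}$ fixed; "with high probability" means with probability tending to $1$ as $n\to\infty$. *)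

theory Defs
  imports "HOL-Probability.Probability" "HOL-Library.Landau_Symbols"
begin

text \<open>Vectors in R^n are functions on {1..n}, and an N x n matrix is a function
  of a row index in {1..N} and a column index in {1..n}; values at other indices are never used.
  In particular L2_set v J is the Euclidean norm of the restriction of v to J.\<close>

definition mat_vec :: "nat \<Rightarrow> (nat \<Rightarrow> nat \<Rightarrow> real) \<Rightarrow> (nat \<Rightarrow> real) \<Rightarrow> nat \<Rightarrow> real" where
  "mat_vec n A v = (\<lambda>i. \<Sum>j\<in>{1..n}. A i j * v j)"

definition smin :: "nat \<Rightarrow> nat \<Rightarrow> (nat \<Rightarrow> nat \<Rightarrow> real) \<Rightarrow> real" where
  "smin N n A = (INF v\<in>{v. L2_set v {1..n} = 1}. L2_set (mat_vec n A v) {1..N})"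

definition right_singular_vector ::
  "nat \<Rightarrow> nat \<Rightarrow> (nat \<Rightarrow> nat \<Rightarrow> real) \<Rightarrow> real \<Rightarrow> (nat \<Rightarrow> real) \<Rightarrow> bool" where
  "right_singular_vector N n A s v \<longleftrightarrow>
     L2_set v {1..n} = 1 \<and>
     (\<exists>w. L2_set w {1..N} = 1 \<and>
        (\<forall>i\<in>{1..N}. mat_vec n A v i = s * w i) \<and>
        (\<forall>j\<in>{1..n}. mat_vec N (\<lambda>j i. A i j) w j = s * v j))"

text \<open>For N \<ge> n \<ge> 1 such a vector exists. It is unique at best up to sign, and the smallest
  singular value may be degenerate, so this is a predicate rather than a function of A.\<close>

definition bottom_singular_vector ::
  "nat \<Rightarrow> nat \<Rightarrow> (nat \<Rightarrow> nat \<Rightarrow> real) \<Rightarrow> (nat \<Rightarrow> real) \<Rightarrow> bool" where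
  "bottom_singular_vector N n A v \<longleftrightarrow> right_singular_vector N n A (smin N n A) v"

definition heavy_tailed_law :: "real measure \<Rightarrow> real \<Rightarrow> bool" where
  "heavy_tailed_law \<mu> \<alpha> \<longleftrightarrow>
     prob_space \<mu> \<and> sets \<mu> = sets borel \<and>
     (\<exists>Cl>0. \<exists>Cu>0. \<exists>T0>0. \<forall>t\<ge>T0.
        Cl * t powr (- \<alpha>) \<le> measure \<mu> {x. \<bar>x\<bar> > t} \<and>
        measure \<mu> {x. \<bar>x\<bar> > t} \<le> Cu * t powr (- \<alpha>))"

definition symmetric_law :: "real measure \<Rightarrow> bool" where
  "symmetric_law \<mu> \<longleftrightarrow> distr \<mu> borel uminus = \<mu>"

definition iid_matrix ::
  "'w measure \<Rightarrow> real measure \<Rightarrow> nat \<Rightarrow> nat \<Rightarrow> (nat \<Rightarrow> nat \<Rightarrow> 'w \<Rightarrow> real) \<Rightarrow> bool" where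
  "iid_matrix M \<mu> N n X \<longleftrightarrow>
     prob_space M \<and>
     prob_space.indep_vars M (\<lambda>_. borel) (\<lambda>(i, j). X i j) ({1..N} \<times> {1..n}) \<and>
     (\<forall>i\<in>{1..N}. \<forall>j\<in>{1..n}. distr M borel (X i j) = \<mu>)"

end

theory Submission
  imports Defs "HOL-Real_Asymp.Real_Asymp"
begin

text \<open>Write L = n^(1/alpha). The smallest singular value is o(L): a single column has norm at most
  kappa L with probability bounded below (a Laplace transform estimate that uses alpha < 2), so some
  column does with high probability. Conversely, no spread vector v, meaning one with more than
  epsilon n entries of size at least sqrt(delta/n), satisfies |Xv| <= kappa L once kappa is small.
  To see this, discard the small proportion of rows that contain an entry larger than R L. The
  truncated matrix Y has Frobenius norm O(sqrt n L), and rounding v to the lattice of mesh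
  kappa/sqrt n, greedily one coordinate at a time, moves Yv by at most kappa |Y|_F / sqrt n = O(kappa L);
  no control of the operator norm is needed. The lattice points in question number at most
  (C/kappa)^n. For a spread lattice point each row is small with probability O(kappa^gamma), for any
  gamma < 1, and all but a small proportion of the N >= a n independent rows must be small, so with
  gamma close to 1 the union bound wins because a > 1. Hence for every fixed epsilon the bottom
  singular vector has at most epsilon n entries of size at least sqrt(delta/n), and epsilon may tend
  to 0 slowly with n.\<close>

section \<open>Heavy-tailed laws\<close>

text \<open>The largest entries of X have order n^(2/alpha), far above L, so a comparison of Xv with
  a nearby net point through the operator norm would lose everything. The level R L works because
  the expected number of entries above it is O(n R^(-alpha)), which spoils only a small proportion
  of rows, while for fixed R the truncated squares sum to O(n L^2). The order of the constants is
  decisive: the proportion of discarded rows, R, the Frobenius constant and the row threshold H L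
  are fixed before kappa. The threshold stays free of kappa because v is scaled by sqrt n / kappa,
  while |Xv| is at most kappa L and the rounding error of the scaled vector is O(sqrt n L). A row
  sum at a spread lattice point has natural size L / kappa, hence lies below H L with probability
  close to order kappa. With (1 + beta) n such rows, the probability beats the kappa^(-n) lattice
  points. All estimates are made outside one measurable exceptional set that is fixed before a
  singular vector is chosen, so they cover every choice of it.\<close>

locale heavy_tail = prob_space \<mu> for \<mu> :: "real measure" +
  fixes \<alpha> C Cl T0 :: real
  assumes sets_borel [measurable_cong]: "sets \<mu> = sets borel"
    and alpha_pos: "0 < \<alpha>" and alpha_less_2: "\<alpha> < 2"
    and C_pos: "0 < C" and Cl_pos: "0 < Cl" and T0_pos: "0 < T0"
    and tail_lower: "t \<ge> T0 \<Longrightarrow> Cl * t powr (- \<alpha>) \<le> prob {x. \<bar>x\<bar> > t}"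
    and tail_upper: "t > 0 \<Longrightarrow> prob {x. \<bar>x\<bar> > t} \<le> C * t powr (- \<alpha>)"
    and symmetric: "distr \<mu> borel uminus = \<mu>"

lemma heavy_tailed_law_imp_heavy_tail:
  assumes "heavy_tailed_law \<mu> \<alpha>" "symmetric_law \<mu>" "0 < \<alpha>" "\<alpha> < 2"
  shows "\<exists>C Cl T0. heavy_tail \<mu> \<alpha> C Cl T0"
proof -
  obtain Cl Cu T0 where c: "Cl > 0" "Cu > 0" "T0 > 0" and
    t: "\<And>t. t \<ge> T0 \<Longrightarrow> Cl * t powr (- \<alpha>) \<le> measure \<mu> {x. \<bar>x\<bar> > t}"
       "\<And>t. t \<ge> T0 \<Longrightarrow> measure \<mu> {x. \<bar>x\<bar> > t} \<le> Cu * t powr (- \<alpha>)"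
    and p: "prob_space \<mu>" and s: "sets \<mu> = sets borel"
    using assms(1) unfolding heavy_tailed_law_def by auto
  interpret prob_space \<mu> by (rule p)
  \<comment> \<open>Below \<open>T0\<close> the upper tail bound has to be trivial: there
    \<open>C * t powr (- \<alpha>)\<close> is at least 1 as soon as
    \<open>C \<ge> T0 powr \<alpha>\<close>.\<close>
  define C where "C = max Cu (T0 powr \<alpha>)"
  have "prob {x. \<bar>x\<bar> > t} \<le> C * t powr (- \<alpha>)" if "t > 0" for t
  proof (cases "t \<ge> T0")
    case True
    have "Cu * t powr (- \<alpha>) \<le> C * t powr (- \<alpha>)" unfolding C_def by (intro mult_right_mono) auto
    then show ?thesis using t(2)[OF True] by linarith
  next
    case False
    have "1 = T0 powr \<alpha> * T0 powr (- \<alpha>)" using c by (simp add: powr_minus field_simps)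
    also have "\<dots> \<le> C * t powr (- \<alpha>)"
      using False that c assms(3) unfolding C_def by (intro mult_mono powr_mono2') auto
    finally show ?thesis using prob_le_1 order.trans by blast
  qed
  moreover have "C > 0" using c unfolding C_def by auto
  ultimately have "heavy_tail \<mu> \<alpha> C Cl T0"
    using assms c t s unfolding symmetric_law_def by unfold_locales auto
  then show ?thesis by blast
qed

section \<open>Truncated moments of the law and its characteristic function near zero\<close>

context heavy_tail
begin

lemma space_UNIV [simp]: "space \<mu> = UNIV"
  using sets_eq_imp_space_eq[OF sets_borel] by simp

text \<open>Raising the truncation level from T/2 to T matters only where |x| > T/2, and there by at
  most T^2, so the tail bound prices one dyadic scale.\<close>

lemma truncated_second_moment_step:
  assumes "T > 0"
  shows "expectation (\<lambda>x. min (x\<^sup>2) (T\<^sup>2)) \<le>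
    expectation (\<lambda>x. min (x\<^sup>2) ((T/2)\<^sup>2)) + C * 2 powr \<alpha> * T powr (2 - \<alpha>)"
proof -
  have int: "integrable \<mu> (\<lambda>x. min (x\<^sup>2) (S\<^sup>2))" for S :: real
    by (rule integrable_const_bound[where B = "S\<^sup>2"]) auto
  have "expectation (\<lambda>x. min (x\<^sup>2) (T\<^sup>2)) \<le>
      expectation (\<lambda>x. min (x\<^sup>2) ((T/2)\<^sup>2) + T\<^sup>2 * indicator {x. \<bar>x\<bar> > T/2} x)"
  proof (rule integral_mono[OF int])
    show "integrable \<mu> (\<lambda>x. min (x\<^sup>2) ((T/2)\<^sup>2) + T\<^sup>2 * indicator {x. \<bar>x\<bar> > T/2} x)"
      by (intro Bochner_Integration.integrable_add int integrable_const_bound[where B = "T\<^sup>2"])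
         (auto simp: indicator_def)
    fix x :: real
    show "min (x\<^sup>2) (T\<^sup>2) \<le> min (x\<^sup>2) ((T/2)\<^sup>2) + T\<^sup>2 * indicator {x. \<bar>x\<bar> > T/2} x"
    proof (cases "\<bar>x\<bar> > T/2")
      case False
      then have "x\<^sup>2 \<le> (T/2)\<^sup>2" using assms abs_le_square_iff[of x "T/2"] by auto
      then show ?thesis using False by auto
    qed (simp add: min.coboundedI2 add_increasing)
  qed
  also have "\<dots> = expectation (\<lambda>x. min (x\<^sup>2) ((T/2)\<^sup>2)) + T\<^sup>2 * prob {x. \<bar>x\<bar> > T/2}"
  proof (subst Bochner_Integration.integral_add)
    show "integrable \<mu> (\<lambda>x. T\<^sup>2 * indicator {x. \<bar>x\<bar> > T/2} x)"
      by (rule integrable_const_bound[where B = "T\<^sup>2"]) (auto split: split_indicator)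
  qed (auto intro!: int)
  also have "\<dots> \<le> expectation (\<lambda>x. min (x\<^sup>2) ((T/2)\<^sup>2)) + T\<^sup>2 * (C * (T/2) powr (- \<alpha>))"
    using assms by (intro add_left_mono mult_left_mono tail_upper) auto
  also have "T\<^sup>2 * (C * (T/2) powr (- \<alpha>)) = C * 2 powr \<alpha> * T powr (2 - \<alpha>)"
    using assms by (simp add: powr_divide powr_diff powr_minus field_simps)
  finally show ?thesis .
qed

text \<open>The fixed point of m = 2^(alpha - 2) m + C 2^alpha, that is, the geometric series over
  dyadic scales. Its ratio is below 1 exactly because alpha < 2.\<close>

definition moment_const where "moment_const = C * 2 powr \<alpha> / (1 - 2 powr (\<alpha> - 2))"

lemma moment_const_pos: "moment_const > 0"
proof -
  have "2 powr (\<alpha> - 2) < (1::real)" using alpha_less_2 by (simp add: powr_less_one)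
  then show ?thesis unfolding moment_const_def using C_pos by simp
qed

lemma truncated_second_moment:
  assumes "T > 0"
  shows "expectation (\<lambda>x. min (x\<^sup>2) (T\<^sup>2)) \<le> moment_const * T powr (2 - \<alpha>)"
proof -
  have q: "2 powr (\<alpha> - 2) < (1::real)" using alpha_less_2 by (simp add: powr_less_one)
  \<comment> \<open>Halve the level K times. The first term is the trivial bound at the last level T
    / 2^K, and it vanishes as K grows.\<close>
  have *: "expectation (\<lambda>x. min (x\<^sup>2) (T\<^sup>2)) \<le> T\<^sup>2 * (1/4)^K + moment_const * T powr (2 - \<alpha>)"
    if "T > 0" for K T
    using that
  proof (induction K arbitrary: T)
    case 0
    have "expectation (\<lambda>x. min (x\<^sup>2) (T\<^sup>2)) \<le> expectation (\<lambda>x. T\<^sup>2)"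
      by (intro integral_mono integrable_const_bound[where B = "T\<^sup>2"]) auto
    also have "\<dots> = T\<^sup>2" using prob_space by simp
    finally show ?case using moment_const_pos by (simp add: add_increasing2)
  next
    case (Suc K)
    have "expectation (\<lambda>x. min (x\<^sup>2) (T\<^sup>2)) \<le>
      ((T/2)\<^sup>2 * (1/4)^K + moment_const * (T/2) powr (2 - \<alpha>)) + C * 2 powr \<alpha> * T powr (2 - \<alpha>)"
      using truncated_second_moment_step[OF Suc.prems] Suc.IH[of "T/2"] Suc.prems by simp
    also have "moment_const * (T/2) powr (2 - \<alpha>) = moment_const * 2 powr (\<alpha> - 2) * T powr (2 - \<alpha>)"
      using Suc.prems by (simp add: powr_divide powr_diff field_simps)
    also have "C * 2 powr \<alpha> = moment_const * (1 - 2 powr (\<alpha> - 2))"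
      unfolding moment_const_def using alpha_less_2 by simp
    finally show ?case by (simp add: power2_eq_square field_simps)
  qed
  have "(\<lambda>K. T\<^sup>2 * (1/4)^K + moment_const * T powr (2 - \<alpha>)) \<longlonglongrightarrow> T\<^sup>2 * 0 + moment_const * T powr (2 - \<alpha>)"
    by (intro tendsto_intros LIMSEQ_power_zero) auto
  then show ?thesis
    using *[OF assms] by (intro LIMSEQ_le_const[of _ "moment_const * T powr (2 - \<alpha>)"]) auto
qed

text \<open>Averaging the law with its reflection turns the exponential into a cosine. Only then is
  the modulus taken inside, where it no longer gives the trivial bound 1.\<close>

lemma norm_char_le_integral_cos: "norm (char \<mu> t) \<le> expectation (\<lambda>x. \<bar>cos (t * x)\<bar>)"
proof -
  have int: "integrable \<mu> (\<lambda>x. iexp (t * x))" for t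
    by (rule integrable_const_bound[where B = 1]) auto
  have "char \<mu> t = char (distr \<mu> borel uminus) t" by (simp add: symmetric)
  also have "\<dots> = (CLINT x|\<mu>. iexp (- t * x))"
    unfolding char_def by (subst integral_distr) auto
  finally have "2 * char \<mu> t = (CLINT x|\<mu>. iexp (t * x)) + (CLINT x|\<mu>. iexp (- t * x))"
    by (simp add: char_def)
  also have "\<dots> = (CLINT x|\<mu>. iexp (t * x) + iexp (- t * x))"
    by (rule Bochner_Integration.integral_add[symmetric]) (rule int)+
  also have "\<dots> = (CLINT x|\<mu>. 2 * complex_of_real (cos (t * x)))"
    by (intro Bochner_Integration.integral_cong refl) (auto simp: complex_eq_iff Re_exp Im_exp)
  also have "\<dots> = 2 * (CLINT x|\<mu>. complex_of_real (cos (t * x)))"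
    by simp
  finally have "char \<mu> t = (CLINT x|\<mu>. complex_of_real (cos (t * x)))" by simp
  then show ?thesis using integral_norm_bound[of \<mu> "\<lambda>x. complex_of_real (cos (t * x))"] by simp
qed

text \<open>Where |t x| lies between 1/B and 1 the cosine stays away from 1, and this shell of x
  carries probability at least |t|^alpha. Only small t can be treated: a lattice-valued law has
  characteristic function of modulus 1 at some other frequencies.\<close>

lemma norm_char_le:
  shows "\<exists>c>0. \<exists>t0>0. \<forall>t. \<bar>t\<bar> \<le> t0 \<longrightarrow> norm (char \<mu> t) \<le> exp (- c * \<bar>t\<bar> powr \<alpha>)"
proof -
  have "Cl * T0 powr (-\<alpha>) \<le> C * T0 powr (-\<alpha>)"
    using tail_lower[of T0] tail_upper[of T0] T0_pos by linarith
  then have ClC: "Cl \<le> C" using T0_pos by (simp add: mult_le_cancel_right)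
  \<comment> \<open>With this choice the lower tail bound at radius 1/(B t) exceeds the upper tail
    bound at 1/t by exactly \<open>t powr \<alpha>\<close>.\<close>
  define B where "B = ((C + 1) / Cl) powr (1/\<alpha>)"
  have B1: "B > 1" unfolding B_def using ClC Cl_pos alpha_pos by (intro gr_one_powr) auto
  have BC: "Cl * B powr \<alpha> = C + 1" unfolding B_def using Cl_pos C_pos alpha_pos by (simp add: powr_powr)
  define c where "c = 1 - cos (1/B)"
  have "1/B \<le> 1" using B1 by simp
  then have "1/B \<le> pi" using pi_gt3 by linarith
  then have "cos (1/B) < cos 0" using B1 by (intro cos_monotone_0_pi) auto
  then have c: "c > 0" unfolding c_def by simp
  \<comment> \<open>For t up to \<open>t0\<close> the inner radius 1/(B t) is at least
    \<open>T0\<close>, where the lower tail bound becomes available.\<close>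
  define t0 where "t0 = 1 / (B * T0)"
  have t0: "t0 > 0" unfolding t0_def using B1 T0_pos by auto
  have main: "expectation (\<lambda>x. \<bar>cos (t * x)\<bar>) \<le> exp (- c * t powr \<alpha>)" if t: "0 < t" "t \<le> t0" for t
  proof -
    let ?S = "{x::real. \<bar>x\<bar> > 1/(B*t)} - {x. \<bar>x\<bar> > 1/t}"
    have "prob ?S = prob {x. \<bar>x\<bar> > 1/(B*t)} - prob {x. \<bar>x\<bar> > 1/t}"
    proof (rule finite_measure_Diff)
      have "1/(B*t) \<le> 1/t" using t B1 by (simp add: field_simps)
      then show "{x. \<bar>x\<bar> > 1/t} \<subseteq> {x. \<bar>x\<bar> > 1/(B*t)}" by auto
    qed auto
    moreover have "Cl * (1/(B*t)) powr (-\<alpha>) \<le> prob {x. \<bar>x\<bar> > 1/(B*t)}"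
      using t B1 T0_pos unfolding t0_def by (intro tail_lower) (auto simp: field_simps)
    moreover have "prob {x. \<bar>x\<bar> > 1/t} \<le> C * (1/t) powr (-\<alpha>)" using t by (intro tail_upper) auto
    ultimately have "prob ?S \<ge> Cl * (1/(B*t)) powr (-\<alpha>) - C * (1/t) powr (-\<alpha>)" by linarith
    also have "Cl * (1/(B*t)) powr (-\<alpha>) - C * (1/t) powr (-\<alpha>) = (Cl * B powr \<alpha> - C) * t powr \<alpha>"
      using t B1 by (simp add: powr_minus powr_divide powr_mult field_simps)
    finally have S: "prob ?S \<ge> t powr \<alpha>" using BC by simp
    have "expectation (\<lambda>x. \<bar>cos (t * x)\<bar>) \<le> expectation (\<lambda>x. 1 - c * indicator ?S x)"
    proof (rule integral_mono)
      show "integrable \<mu> (\<lambda>x. \<bar>cos (t * x)\<bar>)" by (rule integrable_const_bound[where B = 1]) auto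
      show "integrable \<mu> (\<lambda>x. 1 - c * indicator ?S x)"
        by (rule integrable_const_bound[where B = "1+\<bar>c\<bar>"]) (auto simp: indicator_def)
      fix x
      show "\<bar>cos (t * x)\<bar> \<le> 1 - c * indicator ?S x"
      proof (cases "x \<in> ?S")
        case True
        then have "\<bar>t * x\<bar> \<le> 1" "1/B \<le> \<bar>t * x\<bar>"
          using t B1 by (auto simp: abs_mult field_simps)
        moreover have "\<bar>cos (t * x)\<bar> = cos \<bar>t * x\<bar>"
          using \<open>\<bar>t * x\<bar> \<le> 1\<close> pi_gt3 by (subst abs_of_nonneg) (auto intro!: cos_ge_zero)
        moreover have "cos \<bar>t * x\<bar> \<le> cos (1/B)"
          using calculation pi_gt3 B1 by (intro cos_monotone_0_pi_le) auto
        ultimately show ?thesis using True unfolding c_def by simp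
      qed auto
    qed
    also have "\<dots> = 1 - c * prob ?S"
    proof (subst Bochner_Integration.integral_diff)
      show "integrable \<mu> (\<lambda>x. c * indicator ?S x)"
        by (rule integrable_const_bound[where B = "\<bar>c\<bar>"]) (auto split: split_indicator)
    qed (use prob_space in auto)
    also have "\<dots> \<le> 1 - c * t powr \<alpha>" using S c by simp
    also have "\<dots> \<le> exp (- c * t powr \<alpha>)" using exp_ge_add_one_self[of "- c * t powr \<alpha>"] by simp
    finally show ?thesis .
  qed
  have "norm (char \<mu> t) \<le> exp (- c * \<bar>t\<bar> powr \<alpha>)" if "\<bar>t\<bar> \<le> t0" for t
  proof (cases "t = 0")
    case True
    then show ?thesis using alpha_pos norm_char_le_integral_cos[of 0] prob_space by simp
  next
    case False
    have "cos (t * x) = cos (\<bar>t\<bar> * x)" for x by (cases "t \<ge> 0") auto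
    then show ?thesis using main[of "\<bar>t\<bar>"] that False norm_char_le_integral_cos[of t] by simp
  qed
  then show ?thesis using c t0 by blast
qed

end

section \<open>Small ball probabilities\<close>

text \<open>An Esseen-type inequality: exp (-x^2/2) is the characteristic function of a standard
  Gaussian g, so Fubini trades the expectation over S for the characteristic function of S at the
  random frequency g.\<close>

lemma (in prob_space) gaussian_smoothing:
  assumes [measurable]: "random_variable borel S"
  shows "expectation (\<lambda>\<omega>. exp (- (S \<omega>)\<^sup>2 / 2)) \<le>
    (LINT g|std_normal_distribution. norm (char (distr M borel S) g))"
proof -
  interpret G: real_distribution std_normal_distribution by (rule real_dist_normal_dist)
  interpret P: pair_prob_space M std_normal_distribution ..
  have "complex_of_real (expectation (\<lambda>\<omega>. exp (- (S \<omega>)\<^sup>2 / 2))) =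
      (CLINT \<omega>|M. char std_normal_distribution (S \<omega>))"
    by (simp add: char_std_normal_distribution)
  also have "\<dots> = (CLINT \<omega>|M. CLINT g|std_normal_distribution. iexp (S \<omega> * g))"
    by (simp add: char_def)
  also have "\<dots> = (CLINT g|std_normal_distribution. CLINT \<omega>|M. iexp (S \<omega> * g))"
    by (rule P.Fubini_integral[symmetric])
       (rule P.integrable_const_bound[where B = 1], auto simp: split_beta')
  also have "\<dots> = (CLINT g|std_normal_distribution. char (distr M borel S) g)"
    unfolding char_def by (subst integral_distr) (auto simp: mult.commute)
  finally have "norm (complex_of_real (expectation (\<lambda>\<omega>. exp (- (S \<omega>)\<^sup>2 / 2)))) =
      norm (CLINT g|std_normal_distribution. char (distr M borel S) g)"
    by (rule arg_cong)
  moreover have "expectation (\<lambda>\<omega>. exp (- (S \<omega>)\<^sup>2 / 2)) \<ge> 0"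
    by (rule Bochner_Integration.integral_nonneg) simp
  ultimately have "expectation (\<lambda>\<omega>. exp (- (S \<omega>)\<^sup>2 / 2)) =
      norm (CLINT g|std_normal_distribution. char (distr M borel S) g)"
    by simp
  then show ?thesis using integral_norm_bound by simp
qed

lemma (in prob_space) prob_abs_le_gaussian:
  assumes [measurable]: "random_variable borel S" and h: "h > 0"
  shows "prob {\<omega> \<in> space M. \<bar>S \<omega>\<bar> \<le> h} \<le> 2 * expectation (\<lambda>\<omega>. exp (- (S \<omega> / h)\<^sup>2 / 2))"
proof -
  have "prob {\<omega> \<in> space M. \<bar>S \<omega>\<bar> \<le> h} = expectation (\<lambda>\<omega>. indicator {\<omega> \<in> space M. \<bar>S \<omega>\<bar> \<le> h} \<omega>)"
    by simp
  also have "\<dots> \<le> expectation (\<lambda>\<omega>. 2 * exp (- (S \<omega> / h)\<^sup>2 / 2))"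
  proof (rule integral_mono)
    fix \<omega>
    have "1 \<le> 2 * exp (- (S \<omega> / h)\<^sup>2 / 2)" if "\<bar>S \<omega>\<bar> \<le> h"
    proof -
      have "(S \<omega> / h)\<^sup>2 \<le> 1" using that h by (simp add: abs_square_le_1)
      then have "exp (-(1/2)) \<le> exp (- (S \<omega> / h)\<^sup>2 / 2)" by simp
      moreover have "exp (-(1/2)) \<ge> (1/2::real)" using exp_ge_add_one_self[of "-(1/2)"] by simp
      ultimately show ?thesis by linarith
    qed
    then show "indicator {\<omega> \<in> space M. \<bar>S \<omega>\<bar> \<le> h} \<omega> \<le> 2 * exp (- (S \<omega> / h)\<^sup>2 / 2)"
      by (auto split: split_indicator)
  next
    show "integrable M (\<lambda>\<omega>. 2 * exp (- (S \<omega> / h)\<^sup>2 / 2))"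
      by (rule integrable_const_bound[where B = 2]) auto
  qed (auto intro!: integrable_real_indicator simp: emeasure_eq_measure)
  finally show ?thesis by simp
qed

lemma std_normal_abs_le:
  assumes "s \<ge> 0"
  shows "measure std_normal_distribution {g. \<bar>g\<bar> \<le> s} \<le> 2 * s"
proof -
  have "emeasure std_normal_distribution {g. \<bar>g\<bar> \<le> s} =
      (\<integral>\<^sup>+x. ennreal (std_normal_density x) * indicator {-s..s} x \<partial>lborel)"
    by (subst emeasure_density) (auto intro!: nn_integral_cong split: split_indicator)
  also have "\<dots> \<le> (\<integral>\<^sup>+x. indicator {-s..s} x \<partial>lborel)"
  proof (intro nn_integral_mono)
    fix x :: real
    have "std_normal_density x \<le> 1 * 1"
      unfolding std_normal_density_def using pi_gt3 by (intro mult_mono) auto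
    then show "ennreal (std_normal_density x) * indicator {-s..s} x \<le> indicator {-s..s} x"
      by (auto split: split_indicator)
  qed
  also have "\<dots> = ennreal (2 * s)" using assms by simp
  finally show ?thesis unfolding measure_def using assms by (simp add: enn2real_leI)
qed

lemma std_normal_tail:
  assumes "\<eta> > 0"
  shows "\<exists>K>0. measure std_normal_distribution {g. \<bar>g\<bar> > K} \<le> \<eta>"
proof -
  interpret G: real_distribution std_normal_distribution by (rule real_dist_normal_dist)
  have empty: "(\<Inter>k. {g. \<bar>g\<bar> > real k}) = {}"
  proof safe
    fix x :: real assume x: "x \<in> (\<Inter>k. {g. \<bar>g\<bar> > real k})"
    obtain k where "\<bar>x\<bar> \<le> real k" using real_arch_simple by blast
    then show "x \<in> {}" using x by (auto dest: spec[of _ k])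
  qed
  have "(\<lambda>k. G.prob {g. \<bar>g\<bar> > real k}) \<longlonglongrightarrow> G.prob (\<Inter>k. {g. \<bar>g\<bar> > real k})"
    by (intro G.finite_Lim_measure_decseq) (auto simp: decseq_def)
  also note empty
  finally have "eventually (\<lambda>k. G.prob {g. \<bar>g\<bar> > real k} < \<eta>) sequentially"
    using assms by (intro order_tendstoD) auto
  then obtain k where "G.prob {g. \<bar>g\<bar> > real k} < \<eta>" by (auto simp: eventually_sequentially)
  \<comment> \<open>The shift by 1 makes the cutoff positive even when k = 0.\<close>
  moreover have "G.prob {g. \<bar>g\<bar> > real k + 1} \<le> G.prob {g. \<bar>g\<bar> > real k}"
    by (intro G.finite_measure_mono) auto
  ultimately show ?thesis by (intro exI[of _ "real k + 1"]) auto
qed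

lemma exp_powr_le_powr:
  fixes c p \<gamma> :: real
  assumes "c > 0" "p > 0"
  shows "\<forall>\<^sub>F \<kappa> in at_right 0. exp (- c * \<kappa> powr (- p)) \<le> \<kappa> powr \<gamma>"
  using assms by real_asymp

text \<open>Factors outside the band of coordinates have modulus at most 1 and are dropped. On the
  band the lower bound on |z j| produces the decay, and the upper bound keeps the frequency within
  \<open>t0\<close>, where the characteristic function is controlled.\<close>

lemma (in heavy_tail) norm_char_prod_le:
  fixes z :: "nat \<Rightarrow> real"
  assumes c: "c > 0" "\<And>t. \<bar>t\<bar> \<le> t0 \<Longrightarrow> norm (char \<mu> t) \<le> exp (- c * \<bar>t\<bar> powr \<alpha>)"
    and pos: "\<kappa> > 0" "b > 0" "D > 0" "h > 0" "s > 0" "n \<ge> 1"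
    and z: "\<epsilon> * real n \<le> card {j\<in>{1..n}. b / \<kappa> \<le> \<bar>z j\<bar> \<and> \<bar>z j\<bar> \<le> D / \<kappa>}"
    and g: "s \<le> \<bar>g\<bar>" "\<bar>g\<bar> \<le> K" and K: "D * K / (\<kappa> * h) \<le> t0"
  shows "(\<Prod>j\<in>{1..n}. norm (char \<mu> (z j * g / h))) \<le> exp (- (c * \<epsilon> * n * (b * s / (\<kappa> * h)) powr \<alpha>))"
proof -
  interpret R: real_distribution \<mu> by unfold_locales (auto simp: sets_borel)
  let ?A = "{j\<in>{1..n}. b / \<kappa> \<le> \<bar>z j\<bar> \<and> \<bar>z j\<bar> \<le> D / \<kappa>}"
  let ?q = "exp (- (c * (b * s / (\<kappa> * h)) powr \<alpha>))"
  have "(\<Prod>j\<in>{1..n}. norm (char \<mu> (z j * g / h))) =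
      (\<Prod>j\<in>{1..n}-?A. norm (char \<mu> (z j * g / h))) * (\<Prod>j\<in>?A. norm (char \<mu> (z j * g / h)))"
    by (rule prod.subset_diff) auto
  also have "\<dots> \<le> 1 * (\<Prod>j\<in>?A. ?q)"
  proof (intro mult_mono prod_mono prod_le_1 conjI)
    fix j assume j: "j \<in> ?A"
    have le: "\<bar>z j\<bar> * \<bar>g\<bar> \<le> D / \<kappa> * K" using j g pos by (intro mult_mono) auto
    have ge: "b / \<kappa> * s \<le> \<bar>z j\<bar> * \<bar>g\<bar>" using j g pos by (intro mult_mono) auto
    have "\<bar>z j * g / h\<bar> = \<bar>z j\<bar> * \<bar>g\<bar> / h" using pos by (simp add: abs_mult)
    also have "\<dots> \<le> (D / \<kappa> * K) / h" using le pos by (intro divide_right_mono) auto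
    finally have "\<bar>z j * g / h\<bar> \<le> t0" using K by (simp add: field_simps)
    then have "norm (char \<mu> (z j * g / h)) \<le> exp (- c * \<bar>z j * g / h\<bar> powr \<alpha>)" by (rule c(2))
    also have "\<dots> \<le> ?q"
    proof -
      have "b * s / (\<kappa> * h) = (b / \<kappa> * s) / h" by simp
      also have "\<dots> \<le> (\<bar>z j\<bar> * \<bar>g\<bar>) / h" using ge pos by (intro divide_right_mono) auto
      also have "\<dots> = \<bar>z j * g / h\<bar>" using pos by (simp add: abs_mult)
      finally show ?thesis using pos c alpha_pos by (auto intro!: mult_left_mono powr_mono2)
    qed
    finally show "norm (char \<mu> (z j * g / h)) \<le> ?q" .
  qed (auto intro!: R.cmod_char_le_1 prod_nonneg)
  also have "\<dots> = exp (- (c * card ?A * (b * s / (\<kappa> * h)) powr \<alpha>))"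
    by (simp add: exp_of_nat_mult[symmetric] mult_ac)
  also have "\<dots> \<le> exp (- (c * \<epsilon> * n * (b * s / (\<kappa> * h)) powr \<alpha>))"
  proof -
    have "(c * (b * s / (\<kappa> * h)) powr \<alpha>) * (\<epsilon> * n) \<le> (c * (b * s / (\<kappa> * h)) powr \<alpha>) * card ?A"
      using z c by (intro mult_left_mono) auto
    then show ?thesis by (simp add: mult_ac)
  qed
  finally show ?thesis .
qed

text \<open>The Gaussian frequency g is split into |g| <= kappa^gamma and |g| > K, which have
  small probability, and the remaining range, where the characteristic function is tiny.\<close>

lemma (in heavy_tail) small_ball:
  fixes \<epsilon> b D H \<gamma> :: real
  assumes pos: "\<epsilon> > 0" "b > 0" "D > 0" "H > 0" "0 < \<gamma>" "\<gamma> < 1"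
  shows "\<forall>\<^sub>F \<kappa> in at_right 0. \<exists>n0. \<forall>n\<ge>n0. \<forall>M Y z. prob_space (M :: 'w measure) \<longrightarrow>
    prob_space.indep_vars M (\<lambda>_. borel) Y {1..n} \<longrightarrow> (\<forall>j\<in>{1..n}. distr M borel (Y j) = \<mu>) \<longrightarrow>
    \<epsilon> * real n \<le> card {j\<in>{1..n}. b / \<kappa> \<le> \<bar>z j\<bar> \<and> \<bar>z j\<bar> \<le> D / \<kappa>} \<longrightarrow>
    measure M {\<omega>\<in>space M. \<bar>\<Sum>j\<in>{1..n}. Y j \<omega> * z j\<bar> \<le> H * real n powr (1/\<alpha>)} \<le> 8 * \<kappa> powr \<gamma>"
proof -
  interpret G: real_distribution std_normal_distribution by (rule real_dist_normal_dist)
  obtain c t0 where c: "c > 0" "t0 > 0"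
    "\<And>t. \<bar>t\<bar> \<le> t0 \<Longrightarrow> norm (char \<mu> t) \<le> exp (- c * \<bar>t\<bar> powr \<alpha>)"
    using norm_char_le by blast
  \<comment> \<open>This is the product bound at the frequency kappa^gamma: the factor n^(-1/alpha)
    coming from the scale cancels the number of factors, and kappa^(gamma - 1) remains, which blows
    up since gamma < 1.\<close>
  have "\<forall>\<^sub>F \<kappa> in at_right 0. exp (- (c * \<epsilon> * (b/H) powr \<alpha>) * \<kappa> powr (- ((1-\<gamma>)*\<alpha>))) \<le> \<kappa> powr \<gamma>"
    using pos c alpha_pos by (intro exp_powr_le_powr) auto
  moreover have "\<forall>\<^sub>F \<kappa> in at_right 0. \<kappa> > (0::real)" by (rule eventually_at_right_less)
  ultimately show ?thesis
  proof eventually_elim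
    case (elim \<kappa>)
    obtain K where K: "K > 0" "G.prob {g. \<bar>g\<bar> > K} \<le> \<kappa> powr \<gamma>"
      using std_normal_tail[of "\<kappa> powr \<gamma>"] elim by auto
    \<comment> \<open>The cutoff \<open>K\<close> depends on kappa, so n must be large in terms of
      kappa before all relevant frequencies drop below \<open>t0\<close>.\<close>
    have "LIM n sequentially. H * real n powr (1/\<alpha>) :> at_top" using pos alpha_pos by real_asymp
    then have "\<forall>\<^sub>F n in sequentially. H * real n powr (1/\<alpha>) \<ge> D * K / (\<kappa> * t0)"
      by (simp add: filterlim_at_top)
    then obtain n0 where n0: "\<And>n. n \<ge> n0 \<Longrightarrow> H * real n powr (1/\<alpha>) \<ge> D * K / (\<kappa> * t0)"
      by (auto simp: eventually_sequentially)
    show ?case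
    proof (intro exI[of _ "max n0 1"] allI impI)
      fix n and M :: "'w measure" and Y z
      assume n: "max n0 1 \<le> n" and "prob_space M" and ind: "prob_space.indep_vars M (\<lambda>_. borel) Y {1..n}"
        and distr: "\<forall>j\<in>{1..n}. distr M borel (Y j) = \<mu>"
        and z: "\<epsilon> * real n \<le> card {j\<in>{1..n}. b / \<kappa> \<le> \<bar>z j\<bar> \<and> \<bar>z j\<bar> \<le> D / \<kappa>}"
      interpret M: prob_space M by fact
      have [measurable]: "Y j \<in> borel_measurable M" if "j \<in> {1..n}" for j
        using ind that by (auto simp: M.indep_vars_def)
      define h where "h = H * real n powr (1/\<alpha>)"
      have h: "h > 0" using pos n unfolding h_def by auto
      define S where "S \<omega> = (\<Sum>j\<in>{1..n}. Y j \<omega> * z j)" for \<omega>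
      have [measurable]: "S \<in> borel_measurable M" unfolding S_def by measurable
      define s where "s = \<kappa> powr \<gamma>"
      have s: "s > 0" unfolding s_def using elim by auto
      have char: "norm (char (distr M borel (\<lambda>\<omega>. S \<omega> / h)) g) = (\<Prod>j\<in>{1..n}. norm (char \<mu> (z j * g / h)))" for g
      proof -
        have "M.indep_vars (\<lambda>_. borel) (\<lambda>j \<omega>. Y j \<omega> * (z j / h)) {1..n}"
          by (rule M.indep_vars_compose2[OF ind]) auto
        then have "char (distr M borel (\<lambda>\<omega>. \<Sum>j\<in>{1..n}. Y j \<omega> * (z j / h))) g =
            (\<Prod>j\<in>{1..n}. char (distr M borel (\<lambda>\<omega>. Y j \<omega> * (z j / h))) g)"
          by (rule M.char_distr_sum)
        also have "\<dots> = (\<Prod>j\<in>{1..n}. char \<mu> (z j * g / h))"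
        proof (rule prod.cong[OF refl])
          fix j assume j: "j \<in> {1..n}"
          have "char (distr M borel (\<lambda>\<omega>. Y j \<omega> * (z j / h))) g = char (distr M borel (Y j)) (z j * g / h)"
            using j unfolding char_def by (subst (1 2) integral_distr) (auto simp: mult_ac)
          then show "char (distr M borel (\<lambda>\<omega>. Y j \<omega> * (z j / h))) g = char \<mu> (z j * g / h)"
            using distr j by simp
        qed
        finally show ?thesis unfolding S_def by (simp add: sum_divide_distrib prod_norm)
      qed
      have "n \<ge> n0" using n by simp
      then have DK: "D * K / (\<kappa> * h) \<le> t0"
        using n0[of n] h c elim by (simp add: h_def[symmetric] field_simps)
      have expo: "c * \<epsilon> * n * (b * s / (\<kappa> * h)) powr \<alpha> = (c * \<epsilon> * (b/H) powr \<alpha>) * \<kappa> powr (- ((1-\<gamma>)*\<alpha>))"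
      proof -
        have "b * s / (\<kappa> * h) = (b / H) * \<kappa> powr (\<gamma> - 1) / real n powr (1/\<alpha>)"
          using elim pos unfolding s_def h_def by (simp add: powr_diff field_simps)
        also have "\<dots> powr \<alpha> = (b/H) powr \<alpha> * (\<kappa> powr (\<gamma> - 1)) powr \<alpha> / (real n powr (1/\<alpha>)) powr \<alpha>"
          using pos by (simp only: powr_mult powr_divide)
        also have "\<dots> = (b/H) powr \<alpha> * \<kappa> powr (- ((1-\<gamma>)*\<alpha>)) / n"
          using n alpha_pos by (simp add: powr_powr algebra_simps)
        finally show ?thesis using n by (simp add: field_simps)
      qed
      have bound: "norm (char (distr M borel (\<lambda>\<omega>. S \<omega> / h)) g) \<le>
          indicator {g. \<bar>g\<bar> \<le> s} g + indicator {g. \<bar>g\<bar> > K} g + s" for g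
      proof (cases "\<bar>g\<bar> \<le> s \<or> \<bar>g\<bar> > K")
        case True
        have "norm (char (distr M borel (\<lambda>\<omega>. S \<omega> / h)) g) \<le> 1"
          by (intro real_distribution.cmod_char_le_1 M.real_distribution_distr) auto
        then show ?thesis using True s by (auto split: split_indicator)
      next
        case False
        have "norm (char (distr M borel (\<lambda>\<omega>. S \<omega> / h)) g) \<le>
            exp (- (c * \<epsilon> * n * (b * s / (\<kappa> * h)) powr \<alpha>))"
          unfolding char
          by (rule norm_char_prod_le[where ?t0.0 = t0 and K = K and D = D]) (use c pos h s n z DK False elim in auto)
        also have "\<dots> \<le> s" using elim unfolding expo by (simp add: s_def)
        finally show ?thesis using False by (simp add: add_increasing)
      qed
      have "M.prob {\<omega>\<in>space M. \<bar>S \<omega>\<bar> \<le> h} \<le> 2 * M.expectation (\<lambda>\<omega>. exp (- (S \<omega> / h)\<^sup>2 / 2))"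
        by (rule M.prob_abs_le_gaussian) (use h in auto)
      also have "M.expectation (\<lambda>\<omega>. exp (- (S \<omega> / h)\<^sup>2 / 2)) \<le>
          (LINT g|std_normal_distribution. norm (char (distr M borel (\<lambda>\<omega>. S \<omega> / h)) g))"
        by (rule M.gaussian_smoothing) auto
      also have "\<dots> \<le> (LINT g|std_normal_distribution. indicator {g. \<bar>g\<bar> \<le> s} g + indicator {g. \<bar>g\<bar> > K} g + s)"
      proof (rule integral_mono_AE)
        show "AE g in std_normal_distribution. norm (char (distr M borel (\<lambda>\<omega>. S \<omega> / h)) g) \<le> indicator {g. \<bar>g\<bar> \<le> s} g + indicator {g. \<bar>g\<bar> > K} g + s"
          using bound by simp
        interpret S: real_distribution "distr M borel (\<lambda>\<omega>. S \<omega> / h)" by (rule M.real_distribution_distr) auto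
        show "integrable std_normal_distribution (\<lambda>g. norm (char (distr M borel (\<lambda>\<omega>. S \<omega> / h)) g))"
          by (rule G.integrable_const_bound[where B=1]) (auto intro: S.cmod_char_le_1)
        show "integrable std_normal_distribution (\<lambda>g. indicator {g. \<bar>g\<bar> \<le> s} g + indicator {g. \<bar>g\<bar> > K} g + s)"
          using s by (intro G.integrable_const_bound[where B="2+s"]) (auto split: split_indicator)
      qed
      also have "\<dots> = G.prob {g. \<bar>g\<bar> \<le> s} + G.prob {g. \<bar>g\<bar> > K} + s"
      proof -
        have int: "integrable std_normal_distribution (\<lambda>g. indicator {g. \<bar>g\<bar> \<le> s} g :: real)"
          "integrable std_normal_distribution (\<lambda>g. indicator {g. \<bar>g\<bar> > K} g :: real)"
          by (rule G.integrable_const_bound[where B=1]; auto split: split_indicator)+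
        show ?thesis using G.prob_space int by simp
      qed
      \<comment> \<open>Low frequencies contribute 2 s, the Gaussian tail s and the middle range s.
        The factor 2 from \<open>prob_abs_le_gaussian\<close> then produces the constant 8.\<close>
      also have "\<dots> \<le> 4 * s" using std_normal_abs_le[of s] K s unfolding s_def by simp
      finally show "M.prob {\<omega>\<in>space M. \<bar>\<Sum>j\<in>{1..n}. Y j \<omega> * z j\<bar> \<le> H * real n powr (1/\<alpha>)} \<le> 8 * \<kappa> powr \<gamma>"
        unfolding S_def h_def s_def by simp
    qed
  qed
qed

section \<open>Small columns\<close>

text \<open>Serves for column norms and row sums and, with one-point blocks, for passing from the
  family indexed by pairs to a single row or column.\<close>

lemma (in prob_space) indep_vars_blocks:
  assumes "indep_vars (\<lambda>_. borel) Y I" "\<And>l. l \<in> L \<Longrightarrow> K l \<subseteq> I" "disjoint_family_on K L"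
    and "\<And>l. l \<in> L \<Longrightarrow> f l \<in> borel_measurable (PiM (K l) (\<lambda>_. borel))"
  shows "indep_vars (\<lambda>_. borel) (\<lambda>l \<omega>. f l (\<lambda>k\<in>K l. Y k \<omega>)) L"
  using indep_vars_compose2[OF indep_vars_restrict[OF assms(1-3)] assms(4)] by simp

text \<open>Some index set of size m consists of small variables only, and independence gives p^m
  for each candidate. The crude count 2^card I of candidates costs a constant to the power n, which
  a small kappa absorbs later.\<close>

lemma (in prob_space) prob_many_le:
  fixes S :: "'i \<Rightarrow> 'a \<Rightarrow> real"
  assumes ind: "indep_vars (\<lambda>_. borel) S I" and fin: "finite I"
    and p: "\<And>i. i \<in> I \<Longrightarrow> prob {\<omega>\<in>space M. \<bar>S i \<omega>\<bar> \<le> h} \<le> p" "0 \<le> p"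
  shows "prob {\<omega>\<in>space M. m \<le> card {i\<in>I. \<bar>S i \<omega>\<bar> \<le> h}} \<le> 2 ^ card I * p ^ m"
proof -
  have meas [measurable]: "S i \<in> borel_measurable M" if "i \<in> I" for i
    using ind that by (auto simp: indep_vars_def)
  let ?F = "{J. J \<subseteq> I \<and> card J = m}"
  let ?E = "\<lambda>J. {\<omega>\<in>space M. \<forall>i\<in>J. \<bar>S i \<omega>\<bar> \<le> h}"
  have finF: "finite ?F" using fin by simp
  have E: "?E J \<in> events" if "J \<in> ?F" for J
  proof -
    have "finite J" using that fin finite_subset by blast
    moreover have "{\<omega>\<in>space M. \<bar>S i \<omega>\<bar> \<le> h} \<in> events" if "i \<in> I" for i
      using that by measurable
    ultimately show ?thesis using that by (intro sets.sets_Collect_finite_All) auto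
  qed
  have single: "prob (?E J) \<le> p ^ m" if J: "J \<in> ?F" for J
  \<comment> \<open>The product rule for independent variables is stated for nonempty index sets, so
    the case m = 0 is separate.\<close>
  proof (cases "J = {}")
    case True
    then show ?thesis using J by auto
  next
    case False
    have "finite J" using J fin finite_subset by blast
    have "?E J = (\<Inter>i\<in>J. S i -` {-h..h} \<inter> space M)" using False by (auto simp: abs_le_iff)
    also have "prob \<dots> = (\<Prod>i\<in>J. prob (S i -` {-h..h} \<inter> space M))"
      using J False \<open>finite J\<close> by (intro indep_varsD[OF ind]) auto
    also have "\<dots> \<le> (\<Prod>i\<in>J. p)"
    proof (intro prod_mono conjI)
      fix i assume "i \<in> J"
      have "S i -` {-h..h} \<inter> space M = {\<omega>\<in>space M. \<bar>S i \<omega>\<bar> \<le> h}" by (auto simp: abs_le_iff)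
      then show "prob (S i -` {-h..h} \<inter> space M) \<le> p" using p(1)[of i] \<open>i \<in> J\<close> J by (metis (no_types, lifting) mem_Collect_eq subsetD)
    qed simp
    finally show ?thesis using J by simp
  qed
  have "prob {\<omega>\<in>space M. m \<le> card {i\<in>I. \<bar>S i \<omega>\<bar> \<le> h}} \<le> prob (\<Union>J\<in>?F. ?E J)"
  proof (rule finite_measure_mono)
    show "{\<omega>\<in>space M. m \<le> card {i\<in>I. \<bar>S i \<omega>\<bar> \<le> h}} \<subseteq> (\<Union>J\<in>?F. ?E J)"
    proof safe
      fix \<omega> assume \<omega>: "\<omega> \<in> space M" "m \<le> card {i\<in>I. \<bar>S i \<omega>\<bar> \<le> h}"
      from \<omega>(2) obtain J where "J \<subseteq> {i\<in>I. \<bar>S i \<omega>\<bar> \<le> h}" "card J = m"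
        by (rule obtain_subset_with_card_n)
      then show "\<omega> \<in> (\<Union>J\<in>?F. ?E J)" using \<omega> by auto
    qed
    show "(\<Union>J\<in>?F. ?E J) \<in> events" using finF E by blast
  qed
  also have "\<dots> \<le> (\<Sum>J\<in>?F. prob (?E J))"
    using finF E by (intro measure_UNION_le) auto
  also have "\<dots> \<le> (\<Sum>J\<in>?F. p ^ m)" by (intro sum_mono single)
  also have "\<dots> = card ?F * p ^ m" by simp
  also have "\<dots> \<le> 2 ^ card I * p ^ m"
  proof (intro mult_right_mono)
    have "card ?F \<le> card (Pow I)" using fin by (intro card_mono) auto
    then show "real (card ?F) \<le> 2 ^ card I" using fin by (simp add: card_Pow flip: of_nat_power)
  qed (use p in simp)
  finally show ?thesis .
qed

lemma one_minus_ge_exp: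
  fixes y :: real
  assumes "0 \<le> y" "y \<le> 1/2"
  shows "exp (- 2 * y) \<le> 1 - y"
proof -
  have "1 \<le> (1 - y) * (1 + 2 * y)" using mult_nonneg_nonneg[of y "1 - 2 * y"] assms by (simp add: algebra_simps)
  also have "\<dots> \<le> (1 - y) * exp (2 * y)"
    using assms by (intro mult_left_mono exp_ge_add_one_self) auto
  finally show ?thesis by (simp add: exp_minus field_simps)
qed

section \<open>Laplace transform of squared column norms\<close>

context heavy_tail
begin

text \<open>The integrand dominates 1 - min (x^2) (T^2) / T^2: up to T this is 1 - y <= exp (-y),
  and beyond T the minorant is 0. What remains is the truncated second moment.\<close>

lemma laplace_square_ge:
  assumes "T > 0"
  shows "1 - moment_const * T powr (- \<alpha>) \<le> expectation (\<lambda>x. exp (- (x\<^sup>2 / T\<^sup>2)))"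
proof -
  have int: "integrable \<mu> (\<lambda>x. min (x\<^sup>2) (T\<^sup>2))"
    by (rule integrable_const_bound[where B = "T\<^sup>2"]) auto
  have "1 - moment_const * T powr (- \<alpha>) = 1 - moment_const * T powr (2 - \<alpha>) / T\<^sup>2"
    using assms by (simp add: powr_diff powr_minus field_simps)
  also have "\<dots> \<le> 1 - expectation (\<lambda>x. min (x\<^sup>2) (T\<^sup>2)) / T\<^sup>2"
    using truncated_second_moment[OF assms] by (simp add: divide_right_mono)
  also have "\<dots> = expectation (\<lambda>x. 1 - min (x\<^sup>2) (T\<^sup>2) / T\<^sup>2)"
    using int prob_space by simp
  also have "\<dots> \<le> expectation (\<lambda>x. exp (- (x\<^sup>2 / T\<^sup>2)))"
  proof (rule integral_mono)
    show "integrable \<mu> (\<lambda>x. exp (- (x\<^sup>2 / T\<^sup>2)))" by (rule integrable_const_bound[where B = 1]) auto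
    show "integrable \<mu> (\<lambda>x. 1 - min (x\<^sup>2) (T\<^sup>2) / T\<^sup>2)" using int by simp
    show "1 - min (x\<^sup>2) (T\<^sup>2) / T\<^sup>2 \<le> exp (- (x\<^sup>2 / T\<^sup>2))" for x
      using exp_ge_add_one_self[of "- (x\<^sup>2 / T\<^sup>2)"] assms by (auto simp: min_def)
  qed
  finally show ?thesis .
qed

text \<open>With T = L / Lambda, the Laplace transform of the squared norm is at least exp (-2 m B
  Lambda^alpha), where m is \<open>moment_const\<close>, while the integrand off the event is at
  most exp (-kappa^2 Lambda^2). As alpha < 2, a large Lambda makes the difference positive, and this
  difference bounds the probability from below uniformly in n.\<close>

lemma column_small:
  assumes "\<kappa> > 0" "B > 0"
  shows "\<exists>p>0. p \<le> 1 \<and> (\<exists>n0. \<forall>n\<ge>n0. \<forall>M Y I. prob_space (M :: 'w measure) \<longrightarrow> finite (I :: 'i set) \<longrightarrow>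
    real (card I) \<le> B * real n \<longrightarrow> prob_space.indep_vars M (\<lambda>_. borel) Y I \<longrightarrow>
    (\<forall>i\<in>I. distr M borel (Y i) = \<mu>) \<longrightarrow>
    p \<le> measure M {\<omega>\<in>space M. (\<Sum>i\<in>I. (Y i \<omega>)\<^sup>2) \<le> (\<kappa> * real n powr (1/\<alpha>))\<^sup>2})"
proof -
  have "\<forall>\<^sub>F \<Lambda> in at_top. 2 * moment_const * B * \<Lambda> powr \<alpha> < \<kappa>\<^sup>2 * \<Lambda>\<^sup>2"
    using assms alpha_pos alpha_less_2 moment_const_pos by real_asymp
  moreover have "\<forall>\<^sub>F \<Lambda>::real in at_top. \<Lambda> > 0" by (rule eventually_gt_at_top)
  ultimately have "\<forall>\<^sub>F \<Lambda> in at_top. \<Lambda> > 0 \<and> 2 * moment_const * B * \<Lambda> powr \<alpha> < \<kappa>\<^sup>2 * \<Lambda>\<^sup>2"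
    by eventually_elim auto
  then obtain \<Lambda> where \<Lambda>: "\<Lambda> > 0" "2 * moment_const * B * \<Lambda> powr \<alpha> < \<kappa>\<^sup>2 * \<Lambda>\<^sup>2"
    using eventually_happens'[OF trivial_limit_at_top_linorder] by blast
  define p where "p = exp (- (2 * moment_const * B * \<Lambda> powr \<alpha>)) - exp (- (\<kappa>\<^sup>2 * \<Lambda>\<^sup>2))"
  have "p > 0" unfolding p_def using \<Lambda> by simp
  have "exp (- (2 * moment_const * B * \<Lambda> powr \<alpha>)) \<le> 1" using moment_const_pos assms by simp
  then have "p \<le> 1" unfolding p_def using exp_ge_zero[of "- (\<kappa>\<^sup>2 * \<Lambda>\<^sup>2)"] by linarith
  \<comment> \<open>Large n brings \<open>moment_const * \<Lambda> powr \<alpha> / n\<close> below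
    1/2, the range of \<open>one_minus_ge_exp\<close>.\<close>
  have "LIM n sequentially. real n :> at_top" by (rule filterlim_real_sequentially)
  then have "\<forall>\<^sub>F n in sequentially. real n \<ge> max 1 (2 * moment_const * \<Lambda> powr \<alpha>)"
    unfolding filterlim_at_top by (rule spec)
  then obtain n0 where n0: "\<And>n. n \<ge> n0 \<Longrightarrow> real n \<ge> max 1 (2 * moment_const * \<Lambda> powr \<alpha>)"
    by (auto simp: eventually_sequentially)
  have "p \<le> measure M {\<omega>\<in>space M. (\<Sum>i\<in>I. (Y i \<omega>)\<^sup>2) \<le> (\<kappa> * real n powr (1/\<alpha>))\<^sup>2}"
    if n: "n0 \<le> n" and M: "prob_space M" and I: "finite I" "real (card I) \<le> B * real n"
      and ind: "prob_space.indep_vars M (\<lambda>_. borel) Y I"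
      and distr: "\<forall>i\<in>I. distr M borel (Y i) = \<mu>"
    for n and M :: "'w measure" and Y and I :: "'i set"
  proof -
    interpret M: prob_space M by fact
    have [measurable]: "Y i \<in> borel_measurable M" if "i \<in> I" for i
      using ind that by (auto simp: M.indep_vars_def)
    have npos: "real n \<ge> 1" and n2: "2 * moment_const * \<Lambda> powr \<alpha> \<le> real n" using n0[OF n] by auto
    define L where "L = real n powr (1/\<alpha>)"
    define T where "T = L / \<Lambda>"
    have L: "L > 0" unfolding L_def using npos by simp
    have T: "T > 0" unfolding T_def using L \<Lambda> by simp
    have y: "moment_const * T powr (-\<alpha>) = moment_const * \<Lambda> powr \<alpha> / n"
    proof -
      have "L powr \<alpha> = n" unfolding L_def using npos alpha_pos by (simp add: powr_powr)
      then have "T powr \<alpha> = n / \<Lambda> powr \<alpha>" unfolding T_def by (subst powr_divide) simp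
      then show ?thesis by (simp add: powr_minus divide_inverse)
    qed
    let ?W = "\<lambda>\<omega>. \<Sum>i\<in>I. (Y i \<omega>)\<^sup>2"
    let ?E = "{\<omega>\<in>space M. ?W \<omega> \<le> (\<kappa> * L)\<^sup>2}"
    have "exp (- (2 * moment_const * B * \<Lambda> powr \<alpha>)) \<le> exp (- 2 * (moment_const * \<Lambda> powr \<alpha> / n)) ^ card I"
    proof -
      have "(2 * (moment_const * \<Lambda> powr \<alpha>)) * (real (card I) / real n) \<le> (2 * (moment_const * \<Lambda> powr \<alpha>)) * B"
        using I npos moment_const_pos by (intro mult_left_mono) (auto simp: field_simps)
      then show ?thesis by (simp add: exp_of_nat_mult[symmetric] field_simps)
    qed
    also have "\<dots> \<le> (1 - moment_const * \<Lambda> powr \<alpha> / n) ^ card I"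
      using n2 npos moment_const_pos by (intro power_mono one_minus_ge_exp) (auto simp: field_simps)
    also have "\<dots> \<le> (expectation (\<lambda>x. exp (- (x\<^sup>2 / T\<^sup>2)))) ^ card I"
      using laplace_square_ge[OF T] n2 npos moment_const_pos unfolding y by (intro power_mono) (auto simp: field_simps)
    also have "\<dots> = (\<Prod>i\<in>I. M.expectation (\<lambda>\<omega>. exp (- ((Y i \<omega>)\<^sup>2 / T\<^sup>2))))"
    proof -
      have "M.expectation (\<lambda>\<omega>. exp (- ((Y i \<omega>)\<^sup>2 / T\<^sup>2))) = expectation (\<lambda>x. exp (- (x\<^sup>2 / T\<^sup>2)))" if "i \<in> I" for i
        using that distr integral_distr[of "Y i" M borel "\<lambda>x. exp (- (x\<^sup>2 / T\<^sup>2))"] by simp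
      then show ?thesis by simp
    qed
    also have "\<dots> = M.expectation (\<lambda>\<omega>. \<Prod>i\<in>I. exp (- ((Y i \<omega>)\<^sup>2 / T\<^sup>2)))"
    proof (rule M.indep_vars_lebesgue_integral[symmetric])
      show "M.indep_vars (\<lambda>_. borel) (\<lambda>i \<omega>. exp (- ((Y i \<omega>)\<^sup>2 / T\<^sup>2))) I"
        by (rule M.indep_vars_compose2[OF ind]) auto
      show "integrable M (\<lambda>\<omega>. exp (- ((Y i \<omega>)\<^sup>2 / T\<^sup>2)))" if "i \<in> I" for i
        using that by (intro M.integrable_const_bound[where B = 1]) auto
    qed (use I in auto)
    also have "\<dots> = M.expectation (\<lambda>\<omega>. exp (- (?W \<omega> / T\<^sup>2)))"
      using I by (simp add: exp_sum sum_divide_distrib flip: sum_negf)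
    also have "\<dots> \<le> M.expectation (\<lambda>\<omega>. indicator ?E \<omega> + exp (- (\<kappa>\<^sup>2 * \<Lambda>\<^sup>2)))"
    proof (rule integral_mono)
      show "integrable M (\<lambda>\<omega>. exp (- (?W \<omega> / T\<^sup>2)))"
        by (rule M.integrable_const_bound[where B = 1]) (auto intro!: sum_nonneg divide_nonneg_nonneg)
      show "integrable M (\<lambda>\<omega>. indicator ?E \<omega> + exp (- (\<kappa>\<^sup>2 * \<Lambda>\<^sup>2)))"
        by (rule M.integrable_const_bound[where B = "1 + exp (- (\<kappa>\<^sup>2 * \<Lambda>\<^sup>2))"]) (auto split: split_indicator)
      fix \<omega> assume \<omega>: "\<omega> \<in> space M"
      show "exp (- (?W \<omega> / T\<^sup>2)) \<le> indicator ?E \<omega> + exp (- (\<kappa>\<^sup>2 * \<Lambda>\<^sup>2))"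
      proof (cases "?W \<omega> \<le> (\<kappa> * L)\<^sup>2")
        case True
        have "exp (- (?W \<omega> / T\<^sup>2)) \<le> 1" by (auto intro!: sum_nonneg divide_nonneg_nonneg)
        then show ?thesis using True \<omega> by (simp add: add_increasing2)
      next
        case False
        have "\<kappa>\<^sup>2 * \<Lambda>\<^sup>2 = (\<kappa> * L)\<^sup>2 / T\<^sup>2" unfolding T_def using L by (simp add: power_mult_distrib power_divide)
        also have "\<dots> \<le> ?W \<omega> / T\<^sup>2" using False by (intro divide_right_mono) auto
        finally show ?thesis using False by simp
      qed
    qed
    also have "\<dots> = M.prob ?E + exp (- (\<kappa>\<^sup>2 * \<Lambda>\<^sup>2))"
    proof -
      have "integrable M (indicator ?E :: _ \<Rightarrow> real)"
        by (rule M.integrable_const_bound[where B = 1]) (auto split: split_indicator)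
      then show ?thesis using M.prob_space by simp
    qed
    finally show ?thesis unfolding p_def L_def by simp
  qed
  then show ?thesis using \<open>p > 0\<close> \<open>p \<le> 1\<close> by blast
qed

text \<open>The bound p from \<open>column_small\<close> does not depend on n, so n independent
  columns all fail with probability at most (1 - p)^n.\<close>

lemma some_column_small:
  assumes "\<kappa> > 0" "B > 0" "\<theta> > 0"
  shows "\<exists>n0. \<forall>n\<ge>n0. \<forall>M X N. iid_matrix (M :: 'w measure) \<mu> N n X \<longrightarrow> real N \<le> B * real n \<longrightarrow>
    measure M {\<omega>\<in>space M. \<forall>j\<in>{1..n}. (\<Sum>i\<in>{1..N}. (X i j \<omega>)\<^sup>2) > (\<kappa> * real n powr (1/\<alpha>))\<^sup>2} \<le> \<theta>"
proof -
  obtain p n0 where p: "p > 0" "p \<le> 1" and n0: "\<And>n M Y I. n0 \<le> n \<Longrightarrow> prob_space (M :: 'w measure) \<Longrightarrow> finite (I :: nat set) \<Longrightarrow>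
    real (card I) \<le> B * real n \<Longrightarrow> prob_space.indep_vars M (\<lambda>_. borel) Y I \<Longrightarrow>
    \<forall>i\<in>I. distr M borel (Y i) = \<mu> \<Longrightarrow>
    p \<le> measure M {\<omega>\<in>space M. (\<Sum>i\<in>I. (Y i \<omega>)\<^sup>2) \<le> (\<kappa> * real n powr (1/\<alpha>))\<^sup>2}"
    using column_small[OF assms(1,2), where ?'w = 'w and ?'i = nat] by blast
  have "(\<lambda>n. (1 - p) ^ n) \<longlonglongrightarrow> 0" using p by (intro LIMSEQ_realpow_zero) auto
  then have "\<forall>\<^sub>F n in sequentially. (1 - p) ^ n < \<theta>" using assms by (intro order_tendstoD) auto
  then obtain n1 where n1: "\<And>n. n \<ge> n1 \<Longrightarrow> (1 - p) ^ n < \<theta>" by (auto simp: eventually_sequentially)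
  have "measure M {\<omega>\<in>space M. \<forall>j\<in>{1..n}. (\<Sum>i\<in>{1..N}. (X i j \<omega>)\<^sup>2) > (\<kappa> * real n powr (1/\<alpha>))\<^sup>2} \<le> \<theta>"
    if n: "max 1 (max n0 n1) \<le> n" and iid: "iid_matrix M \<mu> N n X" and N: "real N \<le> B * real n"
    for n and M :: "'w measure" and X N
  proof -
    interpret M: prob_space M using iid unfolding iid_matrix_def by simp
    have ind: "M.indep_vars (\<lambda>_. borel) (\<lambda>(i, j). X i j) ({1..N} \<times> {1..n})"
      and distr: "\<And>i j. i \<in> {1..N} \<Longrightarrow> j \<in> {1..n} \<Longrightarrow> distr M borel (X i j) = \<mu>"
      using iid unfolding iid_matrix_def by auto
    have [measurable]: "X i j \<in> borel_measurable M" if "i \<in> {1..N}" "j \<in> {1..n}" for i j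
      using ind that by (auto simp: M.indep_vars_def)
    define Z where "Z j \<omega> = (\<Sum>i\<in>{1..N}. (X i j \<omega>)\<^sup>2)" for j \<omega>
    define s where "s = (\<kappa> * real n powr (1/\<alpha>))\<^sup>2"
    have "M.indep_vars (\<lambda>_. borel) (\<lambda>j \<omega>. (\<lambda>x. \<Sum>i\<in>{1..N}. (x (i, j))\<^sup>2)
        (\<lambda>k\<in>{1..N}\<times>{j}. (case k of (i, j) \<Rightarrow> X i j) \<omega>)) {1..n}"
      by (rule M.indep_vars_blocks[OF ind])
         (auto simp: disjoint_family_on_def intro!: borel_measurable_sum borel_measurable_power measurable_component_singleton)
    also have "?this \<longleftrightarrow> M.indep_vars (\<lambda>_. borel) Z {1..n}"
      by (intro M.indep_vars_cong) (auto simp: Z_def)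
    finally have indZ: "M.indep_vars (\<lambda>_. borel) Z {1..n}" .
    have small: "p \<le> M.prob {\<omega>\<in>space M. Z j \<omega> \<le> s}" if j: "j \<in> {1..n}" for j
    proof -
      have "M.indep_vars (\<lambda>_. borel) (\<lambda>i \<omega>. (\<lambda>x. x (i, j))
          (\<lambda>k\<in>{(i, j)}. (case k of (i, j) \<Rightarrow> X i j) \<omega>)) {1..N}"
        using j by (intro M.indep_vars_blocks[OF ind])
           (auto simp: disjoint_family_on_def intro!: measurable_component_singleton)
      also have "?this \<longleftrightarrow> M.indep_vars (\<lambda>_. borel) (\<lambda>i. X i j) {1..N}"
        by (intro M.indep_vars_cong) auto
      finally show ?thesis
        unfolding Z_def s_def using n N j distr by (intro n0) (auto intro: M.prob_space_axioms)
    qed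
    have "{\<omega>\<in>space M. \<forall>j\<in>{1..n}. Z j \<omega> > s} = (\<Inter>j\<in>{1..n}. Z j -` {s<..} \<inter> space M)"
      using n by auto
    also have "M.prob \<dots> = (\<Prod>j\<in>{1..n}. M.prob (Z j -` {s<..} \<inter> space M))"
      using n by (intro M.indep_varsD_finite[OF indZ]) auto
    also have "\<dots> \<le> (\<Prod>j\<in>{1..n}. 1 - p)"
    proof (intro prod_mono conjI)
      fix j assume j: "j \<in> {1..n}"
      have [measurable]: "Z j \<in> borel_measurable M" using indZ j by (auto simp: M.indep_vars_def)
      have "Z j -` {s<..} \<inter> space M = space M - {\<omega>\<in>space M. Z j \<omega> \<le> s}" by auto
      then show "M.prob (Z j -` {s<..} \<inter> space M) \<le> 1 - p"
        using small[OF j] by (simp add: M.prob_compl)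
    qed simp
    also have "\<dots> = (1 - p) ^ n" by simp
    also have "\<dots> \<le> \<theta>" using n1[of n] n by simp
    finally show ?thesis unfolding Z_def s_def .
  qed
  then show ?thesis by blast
qed

end

section \<open>Lattice approximation\<close>

text \<open>Each coordinate is rounded up or down so that the new increment has nonpositive inner
  product with the error accumulated so far.\<close>

lemma greedy_rounding:
  fixes c :: "'i \<Rightarrow> 'j \<Rightarrow> real" and y :: "'j \<Rightarrow> real"
  assumes "finite J"
  shows "\<exists>z :: 'j \<Rightarrow> int. (\<forall>j\<in>J. \<bar>of_int (z j) - y j\<bar> \<le> 1) \<and>
    (\<Sum>i\<in>I. (\<Sum>j\<in>J. c i j * (of_int (z j) - y j))\<^sup>2) \<le> (\<Sum>i\<in>I. \<Sum>j\<in>J. (c i j)\<^sup>2)"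
  using assms
proof (induction J rule: finite_induct)
  case (insert k J)
  then obtain z :: "'j \<Rightarrow> int" where z: "\<And>j. j \<in> J \<Longrightarrow> \<bar>of_int (z j) - y j\<bar> \<le> 1"
    "(\<Sum>i\<in>I. (\<Sum>j\<in>J. c i j * (of_int (z j) - y j))\<^sup>2) \<le> (\<Sum>i\<in>I. \<Sum>j\<in>J. (c i j)\<^sup>2)" by blast
  define s where "s i = (\<Sum>j\<in>J. c i j * (of_int (z j) - y j))" for i
  define ip where "ip = (\<Sum>i\<in>I. s i * c i k)"
  obtain m :: int where m: "\<bar>of_int m - y k\<bar> \<le> 1" "(of_int m - y k) * ip \<le> 0"
  proof (cases "ip \<ge> 0")
    case True
    show ?thesis using True by (intro that[of "\<lfloor>y k\<rfloor>"]) (linarith, simp add: mult_le_0_iff)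
  next
    case False
    show ?thesis using False by (intro that[of "\<lceil>y k\<rceil>"]) (linarith, simp add: mult_le_0_iff)
  qed
  define \<theta> where "\<theta> = of_int m - y k"
  have th: "\<theta>\<^sup>2 \<le> 1" "\<theta> * ip \<le> 0" using m unfolding \<theta>_def by (auto simp: abs_square_le_1)
  have eq: "(\<Sum>j\<in>insert k J. c i j * (of_int ((z(k := m)) j) - y j)) = \<theta> * c i k + s i" for i
  proof -
    have "(\<Sum>j\<in>J. c i j * (of_int ((z(k := m)) j) - y j)) = s i"
      unfolding s_def using insert.hyps by (intro sum.cong) auto
    then show ?thesis using insert.hyps by (simp add: \<theta>_def mult.commute)
  qed
  \<comment> \<open>The cross term is nonpositive and the rounding step is at most 1, so the squared
    error grows by at most the squared norm of column k.\<close>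
  have "(\<Sum>i\<in>I. (\<theta> * c i k + s i)\<^sup>2) = \<theta>\<^sup>2 * (\<Sum>i\<in>I. (c i k)\<^sup>2) + 2 * (\<theta> * ip) + (\<Sum>i\<in>I. (s i)\<^sup>2)"
    unfolding ip_def by (simp add: power2_sum power_mult_distrib sum.distrib sum_distrib_left mult_ac)
  also have "\<dots> \<le> 1 * (\<Sum>i\<in>I. (c i k)\<^sup>2) + 0 + (\<Sum>i\<in>I. \<Sum>j\<in>J. (c i j)\<^sup>2)"
    using th z(2) unfolding s_def by (intro add_mono mult_right_mono) (auto intro: sum_nonneg)
  also have "\<dots> = (\<Sum>i\<in>I. \<Sum>j\<in>insert k J. (c i j)\<^sup>2)"
    using insert.hyps by (simp add: sum.distrib)
  finally have "(\<Sum>i\<in>I. (\<Sum>j\<in>insert k J. c i j * (of_int ((z(k := m)) j) - y j))\<^sup>2) \<le> (\<Sum>i\<in>I. \<Sum>j\<in>insert k J. (c i j)\<^sup>2)"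
    unfolding eq .
  then show ?case using z(1) m(1) insert.hyps by (intro exI[of _ "z(k := m)"]) auto
qed simp

text \<open>The l1 norm is used because exponential weights in |z j| factorise over coordinates,
  which makes counting easy. A scaled unit vector has l1 norm at most n / kappa, and rounding adds
  at most n, so radius 2 n / kappa suffices for kappa <= 1. Extensionality makes the set
  finite.\<close>

definition int_l1_ball :: "nat \<Rightarrow> real \<Rightarrow> (nat \<Rightarrow> int) set" where
  "int_l1_ball n L = {z \<in> {1..n} \<rightarrow>\<^sub>E UNIV. (\<Sum>j\<in>{1..n}. \<bar>real_of_int (z j)\<bar>) \<le> L}"

text \<open>Each half line gives a geometric series of ratio exp (-s), with sum at most 2/s because
  1 - exp (-s) >= s/2 in this range. The bound is uniform in m.\<close>

lemma sum_exp_abs_le: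
  fixes s :: real
  assumes "0 < s" "s \<le> 1"
  shows "(\<Sum>k\<in>{-int m..int m}. exp (- (s * \<bar>real_of_int k\<bar>))) \<le> 4 / s"
proof -
  let ?f = "\<lambda>k::int. exp (- (s * \<bar>real_of_int k\<bar>))"
  have q: "exp (-s) \<le> 1 - s/2"
  proof -
    have "exp (- 2 * (s/2)) \<le> 1 - s/2" using assms by (intro one_minus_ge_exp) auto
    then show ?thesis by simp
  qed
  have geo: "(\<Sum>k\<le>m. ?f (int k)) \<le> 2 / s"
  proof -
    have "(\<Sum>k\<le>m. ?f (int k)) = (\<Sum>k\<le>m. exp (-s) ^ k)"
      by (simp add: exp_of_nat_mult[symmetric] mult_ac)
    also have "\<dots> \<le> (\<Sum>k. exp (-s) ^ k)"
      using assms by (intro sum_le_suminf summable_geometric) auto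
    also have "\<dots> = 1 / (1 - exp (-s))" using assms by (intro suminf_geometric) auto
    also have "\<dots> \<le> 1 / (s/2)" using q assms by (intro divide_left_mono) auto
    finally show ?thesis by simp
  qed
  have "{-int m..int m} \<subseteq> int ` {..m} \<union> (\<lambda>k. - int k) ` {..m}"
  proof
    fix k assume "k \<in> {-int m..int m}"
    then have "k = int (nat k) \<and> nat k \<le> m \<or> k = - int (nat (-k)) \<and> nat (-k) \<le> m" by auto
    then show "k \<in> int ` {..m} \<union> (\<lambda>k. - int k) ` {..m}" by blast
  qed
  then have "(\<Sum>k\<in>{-int m..int m}. ?f k) \<le> (\<Sum>k\<in>int ` {..m} \<union> (\<lambda>k. - int k) ` {..m}. ?f k)"
    by (intro sum_mono2) auto
  also have "\<dots> \<le> (\<Sum>k\<in>int ` {..m}. ?f k) + (\<Sum>k\<in>(\<lambda>k. - int k) ` {..m}. ?f k)"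
    using sum.union_inter[of "int ` {..m}" "(\<lambda>k. - int k) ` {..m}" ?f]
      sum_nonneg[of "int ` {..m} \<inter> (\<lambda>k. - int k) ` {..m}" ?f] by simp
  also have "\<dots> = (\<Sum>k\<le>m. ?f (int k)) + (\<Sum>k\<le>m. ?f (int k))"
    by (subst (1 2) sum.reindex) (auto simp: inj_on_def)
  finally show ?thesis using geo by simp
qed

text \<open>Exponential Markov inequality for counting: each point of the ball has weight exp (s L -
  s |z|_1) >= 1, and the total weight over a box factorises. With s = kappa and L = 2 n / kappa this
  yields (4 exp 2 / kappa)^n.\<close>

lemma int_l1_ball_finite: "finite (int_l1_ball n L)"
  and int_l1_ball_card:
    "0 < s \<Longrightarrow> s \<le> 1 \<Longrightarrow> real (card (int_l1_ball n L)) \<le> exp (s * L) * (4 / s) ^ n"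
proof -
  define m where "m = nat \<lceil>L\<rceil>"
  let ?P = "{1..n} \<rightarrow>\<^sub>E {-int m..int m}"
  have sub: "int_l1_ball n L \<subseteq> ?P"
  proof
    fix z assume z: "z \<in> int_l1_ball n L"
    have "z j \<in> {-int m..int m}" if j: "j \<in> {1..n}" for j
    proof -
      have "\<bar>real_of_int (z j)\<bar> \<le> (\<Sum>j\<in>{1..n}. \<bar>real_of_int (z j)\<bar>)"
        using j by (intro member_le_sum) auto
      then have "\<bar>real_of_int (z j)\<bar> \<le> L" using z unfolding int_l1_ball_def by simp
      then have "\<bar>z j\<bar> \<le> \<lceil>L\<rceil>" by linarith
      then have "\<bar>z j\<bar> \<le> int m" unfolding m_def by linarith
      then show ?thesis by (simp add: abs_le_iff)
    qed
    then show "z \<in> ?P" using z unfolding int_l1_ball_def by (auto simp: PiE_iff)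
  qed
  have finP: "finite ?P" by (intro finite_PiE) auto
  show fin: "finite (int_l1_ball n L)" by (rule finite_subset[OF sub finP])
  assume s: "0 < s" "s \<le> 1"
  have "real (card (int_l1_ball n L)) = (\<Sum>z\<in>int_l1_ball n L. 1)" by simp
  also have "\<dots> \<le> (\<Sum>z\<in>int_l1_ball n L. exp (s * L) * (\<Prod>j\<in>{1..n}. exp (- (s * \<bar>real_of_int (z j)\<bar>))))"
  proof (intro sum_mono)
    fix z assume "z \<in> int_l1_ball n L"
    then have "s * (\<Sum>j\<in>{1..n}. \<bar>real_of_int (z j)\<bar>) \<le> s * L"
      using s unfolding int_l1_ball_def by (intro mult_left_mono) auto
    then have "1 \<le> exp (s * L - s * (\<Sum>j\<in>{1..n}. \<bar>real_of_int (z j)\<bar>))" by simp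
    also have "\<dots> = exp (s * L) * (\<Prod>j\<in>{1..n}. exp (- (s * \<bar>real_of_int (z j)\<bar>)))"
      by (simp add: exp_sum[symmetric] exp_add[symmetric] sum_negf sum_distrib_left)
    finally show "1 \<le> exp (s * L) * (\<Prod>j\<in>{1..n}. exp (- (s * \<bar>real_of_int (z j)\<bar>)))" .
  qed
  also have "\<dots> \<le> (\<Sum>z\<in>?P. exp (s * L) * (\<Prod>j\<in>{1..n}. exp (- (s * \<bar>real_of_int (z j)\<bar>))))"
    by (intro sum_mono2 finP sub mult_nonneg_nonneg prod_nonneg) auto
  also have "\<dots> = exp (s * L) * (\<Prod>j\<in>{1..n}. \<Sum>k\<in>{-int m..int m}. exp (- (s * \<bar>real_of_int k\<bar>)))"
    by (subst prod_sum_PiE) (auto simp: sum_distrib_left)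
  also have "\<dots> \<le> exp (s * L) * (\<Prod>j\<in>{1..n}. 4 / s)"
    using s by (intro mult_left_mono prod_mono conjI sum_exp_abs_le sum_nonneg) auto
  finally show "real (card (int_l1_ball n L)) \<le> exp (s * L) * (4 / s) ^ n" by simp
qed

section \<open>From a spread bottom singular vector to a lattice point\<close>

lemma bottom_singular_vector_norm_le:
  assumes v: "bottom_singular_vector N n x v" and j: "j \<in> {1..n}"
    and col: "(\<Sum>i\<in>{1..N}. (x i j)\<^sup>2) \<le> s\<^sup>2" and s: "s \<ge> 0"
  shows "(\<Sum>i\<in>{1..N}. (mat_vec n x v i)\<^sup>2) \<le> s\<^sup>2"
proof -
  \<comment> \<open>The coordinate vector of index j is a competitor in the infimum, so
    \<open>smin\<close> is at most the norm of column j.\<close>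
  let ?e = "\<lambda>k. if k = j then 1 else (0::real)"
  have bdd: "bdd_below ((\<lambda>v. L2_set (mat_vec n x v) {1..N}) ` {v. L2_set v {1..n} = 1})"
    by (rule bdd_belowI2[where m = 0]) (simp add: L2_set_nonneg)
  have e: "L2_set ?e {1..n} = 1"
    using j by (simp add: L2_set_def if_distrib[of "\<lambda>x. x\<^sup>2"] cong: if_cong)
  have "smin N n x \<le> L2_set (mat_vec n x ?e) {1..N}"
    unfolding smin_def using e by (intro cINF_lower[OF bdd]) auto
  also have "\<dots> = sqrt (\<Sum>i\<in>{1..N}. (x i j)\<^sup>2)"
    using j by (simp add: L2_set_def mat_vec_def if_distrib[of "\<lambda>y. _ * y"] cong: if_cong)
  also have "\<dots> \<le> s" using col s real_sqrt_le_mono by fastforce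
  finally have le: "smin N n x \<le> s" .
  have ge: "0 \<le> smin N n x"
    unfolding smin_def using e by (intro cINF_greatest) (auto simp: L2_set_nonneg)
  \<comment> \<open>As the left singular vector has norm 1, the norm of Xv is exactly
    \<open>smin\<close>.\<close>
  obtain w where w: "L2_set w {1..N} = 1" "\<And>i. i \<in> {1..N} \<Longrightarrow> mat_vec n x v i = smin N n x * w i"
    using v unfolding bottom_singular_vector_def right_singular_vector_def by auto
  have "(\<Sum>i\<in>{1..N}. (mat_vec n x v i)\<^sup>2) = (smin N n x)\<^sup>2 * (\<Sum>i\<in>{1..N}. (w i)\<^sup>2)"
    using w(2) by (simp add: power_mult_distrib sum_distrib_left)
  also have "(\<Sum>i\<in>{1..N}. (w i)\<^sup>2) = 1" using w(1) unfolding L2_set_def by simp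
  finally show ?thesis using le ge by (simp add: power_mono)
qed

text \<open>Markov's inequality for counting measure, applied to the oversized coordinates of v and
  to the exceptional rows.\<close>

lemma card_gt_le:
  fixes f :: "'i \<Rightarrow> real"
  assumes "finite I" "\<And>i. i \<in> I \<Longrightarrow> f i \<ge> 0" "(\<Sum>i\<in>I. f i) \<le> k * s" "s > 0"
  shows "real (card {i\<in>I. s < f i}) \<le> k"
proof -
  have "real (card {i\<in>I. s < f i}) * s = (\<Sum>i\<in>{i\<in>I. s < f i}. s)" by simp
  also have "\<dots> \<le> (\<Sum>i\<in>{i\<in>I. s < f i}. f i)" by (intro sum_mono) auto
  also have "\<dots> \<le> (\<Sum>i\<in>I. f i)" using assms by (intro sum_mono2) auto
  finally have "real (card {i\<in>I. s < f i}) * s \<le> k * s" using assms by linarith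
  then show ?thesis using assms by simp
qed

text \<open>Since v is a unit vector, at most epsilon n / 2 coordinates have square above 2 /
  (epsilon n), so half of the large coordinates are also bounded above. The rounding error 1 is
  absorbed by \<open>\<kappa> \<le> sqrt \<delta> / 2\<close> in the lower bound and by
  \<open>\<kappa> \<le> 1\<close> in the upper one.\<close>

lemma card_spread:
  fixes v z :: "nat \<Rightarrow> real" and \<epsilon> \<delta> \<kappa> :: real
  assumes n: "n \<ge> 1" and v: "(\<Sum>j\<in>{1..n}. (v j)\<^sup>2) = 1" and pos: "\<epsilon> > 0" "\<delta> > 0" "\<kappa> > 0" "\<kappa> \<le> 1" "\<kappa> \<le> sqrt \<delta> / 2"
    and spread: "\<epsilon> * n < card {j\<in>{1..n}. sqrt (\<delta> / n) \<le> \<bar>v j\<bar>}"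
    and z: "\<And>j. j \<in> {1..n} \<Longrightarrow> \<bar>z j - v j * sqrt n / \<kappa>\<bar> \<le> 1"
  shows "\<epsilon> / 2 * n \<le> card {j\<in>{1..n}. sqrt \<delta> / 2 / \<kappa> \<le> \<bar>z j\<bar> \<and> \<bar>z j\<bar> \<le> (sqrt (2 / \<epsilon>) + 1) / \<kappa>}"
proof -
  let ?S = "{j\<in>{1..n}. sqrt (\<delta> / n) \<le> \<bar>v j\<bar>}"
  let ?B = "{j\<in>{1..n}. 2 / (\<epsilon> * n) < (v j)\<^sup>2}"
  let ?G = "{j\<in>{1..n}. sqrt \<delta> / 2 / \<kappa> \<le> \<bar>z j\<bar> \<and> \<bar>z j\<bar> \<le> (sqrt (2 / \<epsilon>) + 1) / \<kappa>}"
  have "real (card ?B) \<le> \<epsilon> * n / 2"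
    using n v pos by (intro card_gt_le) auto
  moreover have "?S - ?B \<subseteq> ?G"
  proof
    fix j assume j: "j \<in> ?S - ?B"
    have sq: "sqrt n > 0" using n by simp
    have "sqrt \<delta> / sqrt n \<le> \<bar>v j\<bar>" using j by (simp add: real_sqrt_divide)
    then have "sqrt \<delta> \<le> \<bar>v j\<bar> * sqrt n" using sq by (simp only: pos_divide_le_eq)
    then have lo: "sqrt \<delta> / \<kappa> \<le> \<bar>v j * sqrt n / \<kappa>\<bar>"
      using pos by (simp add: abs_mult divide_right_mono)
    have "(v j)\<^sup>2 \<le> 2 / (\<epsilon> * n)" using j by auto
    then have "\<bar>v j\<bar> \<le> sqrt (2 / (\<epsilon> * n))" by (intro real_le_rsqrt) simp
    also have "\<dots> = sqrt (2 / \<epsilon>) / sqrt n" by (simp add: real_sqrt_divide real_sqrt_mult)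
    finally have "\<bar>v j\<bar> * sqrt n \<le> sqrt (2 / \<epsilon>)" using sq by (simp add: field_simps)
    then have hi: "\<bar>v j * sqrt n / \<kappa>\<bar> \<le> sqrt (2 / \<epsilon>) / \<kappa>"
      using pos by (simp add: abs_mult divide_right_mono)
    have "1 \<le> sqrt \<delta> / 2 / \<kappa>" "1 \<le> 1 / \<kappa>" using pos by (auto simp: field_simps)
    moreover have "\<bar>z j - v j * sqrt n / \<kappa>\<bar> \<le> 1" using z j by auto
    moreover have "(sqrt (2 / \<epsilon>) + 1) / \<kappa> = sqrt (2 / \<epsilon>) / \<kappa> + 1 / \<kappa>" by (rule add_divide_distrib)
    moreover have "sqrt \<delta> / \<kappa> = sqrt \<delta> / 2 / \<kappa> + sqrt \<delta> / 2 / \<kappa>" by simp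
    ultimately have "sqrt \<delta> / 2 / \<kappa> \<le> \<bar>z j\<bar>" "\<bar>z j\<bar> \<le> (sqrt (2 / \<epsilon>) + 1) / \<kappa>"
      using lo hi by linarith+
    then show "j \<in> ?G" using j by blast
  qed
  then have "card (?S - ?B) \<le> card ?G" by (intro card_mono) auto
  moreover have "card ?S - card ?B \<le> card (?S - ?B)" by (intro diff_card_le_card_Diff) auto
  ultimately show ?thesis using spread by linarith
qed

text \<open>The deterministic core: v ranges over a continuum, but a spread v forces an unlikely
  property of some point of a finite set, to which a union bound applies. A row is lost if it has an
  entry above T, a large entry of Xv or a large rounding error, and each reason costs at most tau N
  rows.\<close>

lemma spread_bottom_vector_imp_lattice_point:
  fixes x :: "nat \<Rightarrow> nat \<Rightarrow> real" and \<epsilon> \<delta> \<kappa> \<tau> F L T :: real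
  assumes n: "n \<ge> 1" "n \<le> N"
    and pos: "\<epsilon> > 0" "\<delta> > 0" "\<kappa> > 0" "\<kappa> \<le> 1" "\<kappa> \<le> sqrt \<delta> / 2" "L > 0" "F > 0" "\<tau> > 0"
    and v: "bottom_singular_vector N n x v"
    and spread: "\<epsilon> * n < card {j\<in>{1..n}. sqrt (\<delta> / n) \<le> \<bar>v j\<bar>}"
    and col: "\<exists>j\<in>{1..n}. (\<Sum>i\<in>{1..N}. (x i j)\<^sup>2) \<le> (\<kappa> * L)\<^sup>2"
    and frob: "(\<Sum>i\<in>{1..N}. \<Sum>j\<in>{1..n}. min ((x i j)\<^sup>2) (T\<^sup>2)) \<le> F * n * L\<^sup>2"
    and big: "(\<Sum>i\<in>{1..N}. \<Sum>j\<in>{1..n}. indicator {x. \<bar>x\<bar> > T} (x i j)) \<le> \<tau> * N"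
  shows "\<exists>z\<in>int_l1_ball n (2 * real n / \<kappa>).
    \<epsilon> / 2 * n \<le> card {j\<in>{1..n}. sqrt \<delta> / 2 / \<kappa> \<le> \<bar>real_of_int (z j)\<bar> \<and> \<bar>real_of_int (z j)\<bar> \<le> (sqrt (2 / \<epsilon>) + 1) / \<kappa>} \<and>
    (1 - 3 * \<tau>) * N \<le> card {i\<in>{1..N}. \<bar>\<Sum>j\<in>{1..n}. x i j * real_of_int (z j)\<bar> \<le> (1 + sqrt F) / sqrt \<tau> * L}"
proof -
  have v1: "(\<Sum>j\<in>{1..n}. (v j)\<^sup>2) = 1"
    using v unfolding bottom_singular_vector_def right_singular_vector_def L2_set_def by simp
  define y where "y j = v j * sqrt n / \<kappa>" for j
  define c where "c i j = (if \<bar>x i j\<bar> > T then 0 else x i j)" for i j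
  obtain z0 :: "nat \<Rightarrow> int" where z0: "\<And>j. j \<in> {1..n} \<Longrightarrow> \<bar>of_int (z0 j) - y j\<bar> \<le> 1"
    "(\<Sum>i\<in>{1..N}. (\<Sum>j\<in>{1..n}. c i j * (of_int (z0 j) - y j))\<^sup>2) \<le> (\<Sum>i\<in>{1..N}. \<Sum>j\<in>{1..n}. (c i j)\<^sup>2)"
    using greedy_rounding[OF finite_atLeastAtMost, where I = "{1..N}" and y = y and c = c] by blast
  \<comment> \<open>Restriction only adjusts the values outside the index range, as membership in
    \<open>int_l1_ball\<close> demands.\<close>
  define z where "z = restrict z0 {1..n}"
  have z: "\<bar>of_int (z j) - y j\<bar> \<le> 1" if "j \<in> {1..n}" for j
    using z0(1)[OF that] that unfolding z_def by simp
  have "(\<Sum>i\<in>{1..N}. \<Sum>j\<in>{1..n}. (c i j)\<^sup>2) \<le> (\<Sum>i\<in>{1..N}. \<Sum>j\<in>{1..n}. min ((x i j)\<^sup>2) (T\<^sup>2))"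
  proof (intro sum_mono)
    fix i j
    show "(c i j)\<^sup>2 \<le> min ((x i j)\<^sup>2) (T\<^sup>2)"
    proof (cases "\<bar>x i j\<bar> > T")
      case False
      then have "(x i j)\<^sup>2 \<le> T\<^sup>2" by (intro power2_le_iff_abs_le[THEN iffD2]) auto
      then show ?thesis using False unfolding c_def by auto
    qed (auto simp: c_def)
  qed
  then have zc: "(\<Sum>i\<in>{1..N}. (\<Sum>j\<in>{1..n}. c i j * (of_int (z j) - y j))\<^sup>2) \<le> F * n * L\<^sup>2"
    using z0(2) frob unfolding z_def by simp
  have l1: "z \<in> int_l1_ball n (2 * real n / \<kappa>)"
  proof -
    have "(\<Sum>j\<in>{1..n}. \<bar>real_of_int (z j)\<bar>) \<le> (\<Sum>j\<in>{1..n}. (1 / 2 + n * (v j)\<^sup>2 / 2) / \<kappa> + 1)"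
    proof (intro sum_mono)
      fix j assume j: "j \<in> {1..n}"
      \<comment> \<open>The arithmetic-geometric mean inequality in each coordinate replaces
        Cauchy-Schwarz; summed over a unit vector it gives n / kappa.\<close>
      have "0 \<le> (\<bar>v j\<bar> * sqrt n - 1)\<^sup>2" by simp
      then have "\<bar>v j\<bar> * sqrt n \<le> 1 / 2 + n * (v j)\<^sup>2 / 2"
        by (simp add: power2_diff power_mult_distrib algebra_simps)
      then have "\<bar>y j\<bar> \<le> (1 / 2 + n * (v j)\<^sup>2 / 2) / \<kappa>"
        unfolding y_def using pos by (simp add: abs_mult divide_right_mono)
      then show "\<bar>real_of_int (z j)\<bar> \<le> (1 / 2 + n * (v j)\<^sup>2 / 2) / \<kappa> + 1" using z[OF j] by linarith
    qed
    also have "\<dots> = (n / 2 + n * (\<Sum>j\<in>{1..n}. (v j)\<^sup>2) / 2) / \<kappa> + n"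
      by (simp add: sum.distrib sum_divide_distrib[symmetric] sum_distrib_left[symmetric])
    also have "\<dots> = n / \<kappa> + n" using v1 by simp
    also have "\<dots> \<le> 2 * n / \<kappa>" using pos by (simp add: field_simps mult_left_le_one_le)
    finally show ?thesis unfolding int_l1_ball_def z_def by auto
  qed
  have sp: "\<epsilon> / 2 * n \<le> card {j\<in>{1..n}. sqrt \<delta> / 2 / \<kappa> \<le> \<bar>real_of_int (z j)\<bar> \<and> \<bar>real_of_int (z j)\<bar> \<le> (sqrt (2 / \<epsilon>) + 1) / \<kappa>}"
    by (rule card_spread[OF n(1) v1 _ _ _ _ _ spread]) (use pos z in \<open>auto simp: y_def\<close>)
  \<comment> \<open>The count is taken in \<open>nat\<close>, so a positive row count is at least 1
    and \<open>card ?B1\<close> is at most the total number of large entries.\<close>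
  let ?B1 = "{i\<in>{1..N}. 0 < (\<Sum>j\<in>{1..n}. indicator {x. \<bar>x\<bar> > T} (x i j) :: nat)}"
  let ?B2 = "{i\<in>{1..N}. (\<kappa> * L)\<^sup>2 / (\<tau> * N) < (mat_vec n x v i)\<^sup>2}"
  let ?B3 = "{i\<in>{1..N}. F * n * L\<^sup>2 / (\<tau> * N) < (\<Sum>j\<in>{1..n}. c i j * (of_int (z j) - y j))\<^sup>2}"
  let ?G = "{i\<in>{1..N}. \<bar>\<Sum>j\<in>{1..n}. x i j * real_of_int (z j)\<bar> \<le> (1 + sqrt F) / sqrt \<tau> * L}"
  have B1: "real (card ?B1) \<le> \<tau> * N"
  proof -
    have "card ?B1 = (\<Sum>i\<in>?B1. 1)" by simp
    also have "\<dots> \<le> (\<Sum>i\<in>?B1. \<Sum>j\<in>{1..n}. indicator {x. \<bar>x\<bar> > T} (x i j))" by (intro sum_mono) auto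
    also have "\<dots> \<le> (\<Sum>i\<in>{1..N}. \<Sum>j\<in>{1..n}. indicator {x. \<bar>x\<bar> > T} (x i j))" by (intro sum_mono2) auto
    finally have "real (card ?B1) \<le> real (\<Sum>i\<in>{1..N}. \<Sum>j\<in>{1..n}. indicator {x. \<bar>x\<bar> > T} (x i j))"
      by (rule of_nat_mono)
    also have "\<dots> = (\<Sum>i\<in>{1..N}. \<Sum>j\<in>{1..n}. indicator {x. \<bar>x\<bar> > T} (x i j))"
      by (simp add: indicator_def of_bool_def if_distrib cong: if_cong)
    finally show ?thesis using big by linarith
  qed
  have Npos: "\<tau> * N > 0" using pos n by simp
  have B2: "real (card ?B2) \<le> \<tau> * N"
  proof (rule card_gt_le)
    obtain j where "j \<in> {1..n}" "(\<Sum>i\<in>{1..N}. (x i j)\<^sup>2) \<le> (\<kappa> * L)\<^sup>2" using col by auto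
    then show "(\<Sum>i\<in>{1..N}. (mat_vec n x v i)\<^sup>2) \<le> \<tau> * N * ((\<kappa> * L)\<^sup>2 / (\<tau> * N))"
      using bottom_singular_vector_norm_le[OF v, of j "\<kappa> * L"] pos Npos by simp
  qed (use pos Npos in auto)
  have B3: "real (card ?B3) \<le> \<tau> * N"
    by (rule card_gt_le) (use zc pos Npos n in auto)
  have "{1..N} - ?G \<subseteq> ?B1 \<union> ?B2 \<union> ?B3"
  proof
    fix i assume i: "i \<in> {1..N} - ?G"
    show "i \<in> ?B1 \<union> ?B2 \<union> ?B3"
    proof (rule ccontr)
      assume not: "i \<notin> ?B1 \<union> ?B2 \<union> ?B3"
      have "c i j = x i j" if "j \<in> {1..n}" for j
        using not i that unfolding c_def by (auto simp: indicator_def)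
      \<comment> \<open>On such a row truncation changes nothing, so Xz splits into the rounding
        error and the scaled value of Xv.\<close>
      then have eq: "(\<Sum>j\<in>{1..n}. x i j * real_of_int (z j)) =
          (\<Sum>j\<in>{1..n}. c i j * (of_int (z j) - y j)) + sqrt n / \<kappa> * mat_vec n x v i"
        unfolding mat_vec_def y_def sum_distrib_left by (simp add: algebra_simps flip: sum.distrib)
      have nN: "sqrt n * L / sqrt (\<tau> * N) \<le> L / sqrt \<tau>"
      proof -
        have "sqrt n * L / sqrt (\<tau> * N) = sqrt (n / N) * (L / sqrt \<tau>)"
          by (simp add: real_sqrt_mult real_sqrt_divide)
        also have "\<dots> \<le> 1 * (L / sqrt \<tau>)" using n pos by (intro mult_right_mono) auto
        finally show ?thesis by simp
      qed
      \<comment> \<open>The kappa in the column bound cancels the 1 / kappa of the scaling. This is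
        what keeps the row threshold independent of kappa.\<close>
      have "\<bar>mat_vec n x v i\<bar> \<le> sqrt ((\<kappa> * L)\<^sup>2 / (\<tau> * N))"
        using not i by (intro real_le_rsqrt) auto
      also have "\<dots> = \<kappa> * (L / sqrt (\<tau> * N))" using pos by (simp add: real_sqrt_divide)
      finally have "sqrt n / \<kappa> * \<bar>mat_vec n x v i\<bar> \<le> sqrt n / \<kappa> * (\<kappa> * (L / sqrt (\<tau> * N)))"
        using pos by (intro mult_left_mono) auto
      also have "\<dots> \<le> L / sqrt \<tau>" using nN pos by simp
      finally have 1: "sqrt n / \<kappa> * \<bar>mat_vec n x v i\<bar> \<le> L / sqrt \<tau>" .
      have "\<bar>\<Sum>j\<in>{1..n}. c i j * (of_int (z j) - y j)\<bar> \<le> sqrt (F * n * L\<^sup>2 / (\<tau> * N))"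
        using not i by (intro real_le_rsqrt) auto
      also have "\<dots> = sqrt F * (sqrt n * L / sqrt (\<tau> * N))"
        using pos by (simp add: real_sqrt_divide real_sqrt_mult)
      also have "\<dots> \<le> sqrt F * (L / sqrt \<tau>)" using nN pos by (intro mult_left_mono) auto
      finally have 2: "\<bar>\<Sum>j\<in>{1..n}. c i j * (of_int (z j) - y j)\<bar> \<le> sqrt F * (L / sqrt \<tau>)" .
      have "\<bar>sqrt n / \<kappa> * mat_vec n x v i\<bar> = sqrt n / \<kappa> * \<bar>mat_vec n x v i\<bar>"
        using pos by (simp add: abs_mult)
      moreover have "(1 + sqrt F) / sqrt \<tau> * L = L / sqrt \<tau> + sqrt F * (L / sqrt \<tau>)"
        by (simp add: add_divide_distrib algebra_simps)
      ultimately have "\<bar>\<Sum>j\<in>{1..n}. x i j * real_of_int (z j)\<bar> \<le> (1 + sqrt F) / sqrt \<tau> * L"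
        unfolding eq using 1 2 by linarith
      then show False using i by blast
    qed
  qed
  then have "card ({1..N} - ?G) \<le> card (?B1 \<union> ?B2 \<union> ?B3)" by (intro card_mono) auto
  also have "\<dots> \<le> card ?B1 + card ?B2 + card ?B3"
    using card_Un_le[of "?B1 \<union> ?B2" ?B3] card_Un_le[of ?B1 ?B2] by linarith
  finally have bad: "card ({1..N} - ?G) \<le> card ?B1 + card ?B2 + card ?B3" .
  have "?G \<subseteq> {1..N}" by blast
  from card_Diff_subset[OF finite_subset[OF this finite_atLeastAtMost] this]
    card_mono[OF finite_atLeastAtMost this]
  have G: "N = card ({1..N} - ?G) + card ?G"
    by (simp only: card_atLeastAtMost diff_Suc_1 le_add_diff_inverse2)
  have arith: "real k - 3 * t \<le> real g"
    if "k = d + g" "d \<le> b1 + b2 + b3" "real b1 \<le> t" "real b2 \<le> t" "real b3 \<le> t"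
    for k d g b1 b2 b3 :: nat and t :: real
    using that by linarith
  have "(1 - 3 * \<tau>) * N = N - 3 * (\<tau> * N)" by (simp add: algebra_simps)
  also have "\<dots> \<le> card ?G" by (rule arith[OF G bad B1 B2 B3])
  finally have "(1 - 3 * \<tau>) * N \<le> card ?G" .
  with sp show ?thesis by (intro bexI[OF _ l1] conjI)
qed

section \<open>Spread vectors\<close>

lemma iid_matrix_measurable:
  "iid_matrix M \<mu> N n X \<Longrightarrow> i \<in> {1..N} \<Longrightarrow> j \<in> {1..n} \<Longrightarrow> X i j \<in> borel_measurable M"
  unfolding iid_matrix_def by (auto simp: prob_space.indep_vars_def)

text \<open>Linearity of expectation followed by Markov, with \<open>K\<close> providing
  integrability. It serves both the truncated Frobenius norm and the number of large
  entries.\<close>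

lemma iid_matrix_sum_markov:
  fixes f :: "real \<Rightarrow> real"
  assumes iid: "iid_matrix M \<mu> N n X" and f [measurable]: "f \<in> borel_measurable borel"
    and f01: "\<And>x. 0 \<le> f x" "\<And>x. f x \<le> K" and c: "c > 0"
    and E: "real N * real n * integral\<^sup>L \<mu> f \<le> \<theta> * c"
  shows "measure M {\<omega>\<in>space M. (\<Sum>i\<in>{1..N}. \<Sum>j\<in>{1..n}. f (X i j \<omega>)) > c} \<le> \<theta>"
proof -
  interpret M: prob_space M using iid unfolding iid_matrix_def by simp
  note [measurable] = iid_matrix_measurable[OF iid]
  have distr: "\<And>i j. i \<in> {1..N} \<Longrightarrow> j \<in> {1..n} \<Longrightarrow> distr M borel (X i j) = \<mu>"
    using iid unfolding iid_matrix_def by auto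
  let ?W = "\<lambda>\<omega>. \<Sum>i\<in>{1..N}. \<Sum>j\<in>{1..n}. f (X i j \<omega>)"
  have int: "integrable M (\<lambda>\<omega>. f (X i j \<omega>))" if "i \<in> {1..N}" "j \<in> {1..n}" for i j
    using f01 that by (intro M.integrable_const_bound[where B = K]) auto
  have "M.prob {\<omega>\<in>space M. ?W \<omega> > c} \<le> M.prob {\<omega>\<in>space M. ?W \<omega> \<ge> c}"
    by (intro M.finite_measure_mono) auto
  also have "\<dots> \<le> M.expectation ?W / c"
    by (rule integral_Markov_inequality_measure[where A = "{}"])
       (use c f01 int in \<open>auto intro!: sum_nonneg Bochner_Integration.integrable_sum\<close>)
  also have "M.expectation ?W = (\<Sum>i\<in>{1..N}. \<Sum>j\<in>{1..n}. M.expectation (\<lambda>\<omega>. f (X i j \<omega>)))"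
    using int by (subst Bochner_Integration.integral_sum)
      (auto intro!: sum.cong Bochner_Integration.integral_sum Bochner_Integration.integrable_sum)
  also have "\<dots> = (\<Sum>i\<in>{1..N}. \<Sum>j\<in>{1..n}. integral\<^sup>L \<mu> f)"
  proof (intro sum.cong refl)
    fix i j assume ij: "i \<in> {1..N}" "j \<in> {1..n}"
    have "M.expectation (\<lambda>\<omega>. f (X i j \<omega>)) = integral\<^sup>L (distr M borel (X i j)) f"
      using ij by (intro integral_distr[symmetric]) auto
    then show "M.expectation (\<lambda>\<omega>. f (X i j \<omega>)) = integral\<^sup>L \<mu> f" using distr[OF ij] by simp
  qed
  also have "\<dots> / c \<le> \<theta>" using E c by (simp add: pos_divide_le_eq mult.assoc)
  finally show ?thesis .
qed

lemma iid_matrix_row_sums: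
  assumes iid: "iid_matrix M \<mu> N n X"
  shows "prob_space.indep_vars M (\<lambda>_. borel) (\<lambda>i \<omega>. \<Sum>j\<in>{1..n}. X i j \<omega> * z j) {1..N}"
    and "i \<in> {1..N} \<Longrightarrow> prob_space.indep_vars M (\<lambda>_. borel) (X i) {1..n}"
proof -
  interpret M: prob_space M using iid unfolding iid_matrix_def by simp
  have ind: "M.indep_vars (\<lambda>_. borel) (\<lambda>(i, j). X i j) ({1..N} \<times> {1..n})"
    using iid unfolding iid_matrix_def by auto
  have "M.indep_vars (\<lambda>_. borel) (\<lambda>i \<omega>. (\<lambda>x. \<Sum>j\<in>{1..n}. x (i, j) * z j)
      (\<lambda>k\<in>{i}\<times>{1..n}. (case k of (i, j) \<Rightarrow> X i j) \<omega>)) {1..N}"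
    by (rule M.indep_vars_blocks[OF ind])
       (auto simp: disjoint_family_on_def intro!: borel_measurable_sum borel_measurable_times measurable_component_singleton)
  also have "?this \<longleftrightarrow> M.indep_vars (\<lambda>_. borel) (\<lambda>i \<omega>. \<Sum>j\<in>{1..n}. X i j \<omega> * z j) {1..N}"
    by (intro M.indep_vars_cong) auto
  finally show "M.indep_vars (\<lambda>_. borel) (\<lambda>i \<omega>. \<Sum>j\<in>{1..n}. X i j \<omega> * z j) {1..N}" .
  assume i: "i \<in> {1..N}"
  have "M.indep_vars (\<lambda>_. borel) (\<lambda>j \<omega>. (\<lambda>x. x (i, j))
      (\<lambda>k\<in>{(i, j)}. (case k of (i, j) \<Rightarrow> X i j) \<omega>)) {1..n}"
    using i by (intro M.indep_vars_blocks[OF ind])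
       (auto simp: disjoint_family_on_def intro!: measurable_component_singleton)
  also have "?this \<longleftrightarrow> M.indep_vars (\<lambda>_. borel) (X i) {1..n}"
    by (intro M.indep_vars_cong) auto
  finally show "M.indep_vars (\<lambda>_. borel) (X i) {1..n}" .
qed

text \<open>The number of lattice points, the choice of the small rows and the probability of those
  rows are all bounded by n-th powers, so the union bound reduces to the single inequality
  \<open>base\<close>. The predicate \<open>Q\<close> stands for spreadness, under which each row is
  small with probability at most \<open>p\<close>.\<close>

lemma lattice_union_bound:
  fixes X :: "nat \<Rightarrow> nat \<Rightarrow> 'w \<Rightarrow> real" and \<kappa> p h a \<beta> :: real
  assumes iid: "iid_matrix M \<mu> N n X" and n: "n \<ge> 1"
    and N: "N \<le> (a + 1) * n" and m: "(1 + \<beta>) * n \<le> m"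
    and \<kappa>: "0 < \<kappa>" "\<kappa> \<le> 1" and p: "0 < p" "p \<le> 1"
    and base: "exp 2 * (4 / \<kappa>) * 2 powr (a + 1) * p powr (1 + \<beta>) \<le> q"
    and small: "\<And>z i. Q z \<Longrightarrow> i \<in> {1..N} \<Longrightarrow>
      measure M {\<omega>\<in>space M. \<bar>\<Sum>j\<in>{1..n}. X i j \<omega> * real_of_int (z j)\<bar> \<le> h} \<le> p"
  shows "{\<omega>\<in>space M. \<exists>z\<in>int_l1_ball n (2 * real n / \<kappa>). Q z \<and>
      m \<le> card {i\<in>{1..N}. \<bar>\<Sum>j\<in>{1..n}. X i j \<omega> * real_of_int (z j)\<bar> \<le> h}} \<in> sets M" (is "?E \<in> _")
    and "measure M {\<omega>\<in>space M. \<exists>z\<in>int_l1_ball n (2 * real n / \<kappa>). Q z \<and>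
      m \<le> card {i\<in>{1..N}. \<bar>\<Sum>j\<in>{1..n}. X i j \<omega> * real_of_int (z j)\<bar> \<le> h}} \<le> q ^ n"
proof -
  interpret M: prob_space M using iid unfolding iid_matrix_def by simp
  note [measurable] = iid_matrix_measurable[OF iid]
  let ?Z = "{z\<in>int_l1_ball n (2 * real n / \<kappa>). Q z}"
  let ?S = "\<lambda>z i \<omega>. \<Sum>j\<in>{1..n}. X i j \<omega> * real_of_int (z j)"
  let ?F = "\<lambda>z. {\<omega>\<in>space M. m \<le> card {i\<in>{1..N}. \<bar>?S z i \<omega>\<bar> \<le> h}}"
  have fin: "finite ?Z" using int_l1_ball_finite by simp
  have E: "?E = (\<Union>z\<in>?Z. ?F z)" by auto
  have F: "?F z \<in> sets M" for z
  proof -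
    \<comment> \<open>As a sum of indicators the cardinality is visibly measurable.\<close>
    have "card {i\<in>{1..N}. \<bar>?S z i \<omega>\<bar> \<le> h} = (\<Sum>i\<in>{1..N}. if \<bar>?S z i \<omega>\<bar> \<le> h then 1 else 0)" for \<omega>
      by (simp add: sum.If_cases Int_def)
    then show ?thesis by simp
  qed
  show "?E \<in> sets M" unfolding E using fin F by blast
  have "M.prob ?E \<le> (\<Sum>z\<in>?Z. M.prob (?F z))"
    unfolding E using fin F by (intro measure_UNION_le) auto
  also have "\<dots> \<le> (\<Sum>z\<in>?Z. 2 ^ card {1..N} * p ^ m)"
  proof (intro sum_mono)
    fix z assume "z \<in> ?Z"
    then show "M.prob (?F z) \<le> 2 ^ card {1..N} * p ^ m"
      using p small by (intro M.prob_many_le iid_matrix_row_sums(1)[OF iid]) auto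
  qed
  also have "\<dots> = card ?Z * (2 ^ N * p ^ m)" by simp
  also have "\<dots> \<le> (exp (\<kappa> * (2 * real n / \<kappa>)) * (4 / \<kappa>) ^ n) * ((2 powr (a + 1)) ^ n * (p powr (1 + \<beta>)) ^ n)"
  proof (intro mult_mono)
    have "card ?Z \<le> card (int_l1_ball n (2 * real n / \<kappa>))"
      using int_l1_ball_finite by (intro card_mono) auto
    then show "real (card ?Z) \<le> exp (\<kappa> * (2 * real n / \<kappa>)) * (4 / \<kappa>) ^ n"
      using int_l1_ball_card[OF \<kappa>, of n "2 * real n / \<kappa>"] by linarith
    have "2 ^ N = 2 powr real N" by (simp add: powr_realpow)
    also have "\<dots> \<le> 2 powr ((a + 1) * n)" using N by simp
    also have "\<dots> = (2 powr (a + 1)) ^ n" by (simp add: powr_powr[symmetric] powr_realpow)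
    finally show "2 ^ N \<le> (2 powr (a + 1)) ^ n" .
    have "p ^ m = p powr real m" using p by (simp add: powr_realpow)
    also have "\<dots> \<le> p powr ((1 + \<beta>) * n)" using m p by (intro powr_mono') auto
    also have "\<dots> = (p powr (1 + \<beta>)) ^ n" using p by (simp add: powr_powr[symmetric] powr_realpow)
    finally show "p ^ m \<le> (p powr (1 + \<beta>)) ^ n" .
  qed (use p \<kappa> in auto)
  also have "\<dots> = (exp 2 * (4 / \<kappa>) * 2 powr (a + 1) * p powr (1 + \<beta>)) ^ n"
  proof -
    have "\<kappa> * (2 * real n / \<kappa>) = real n * 2" using \<kappa> by simp
    then have "exp (\<kappa> * (2 * real n / \<kappa>)) = exp 2 ^ n" by (simp only: exp_of_nat_mult)
    then show ?thesis by (simp only: power_mult_distrib mult.assoc)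
  qed
  also have "\<dots> \<le> q ^ n" using base \<kappa> by (intro power_mono) auto
  finally show "M.prob ?E \<le> q ^ n" .
qed

text \<open>The exponent gamma < 1 is chosen with gamma (1 + beta) = 1 + beta/2. One power of kappa
  then pays for the lattice points, and the surplus kappa^(beta/2) absorbs every remaining
  constant.\<close>

lemma exists_base_small:
  fixes a \<beta> :: real
  assumes "\<beta> > 0"
  shows "\<forall>\<^sub>F \<kappa> in at_right 0. 0 < \<kappa> \<and> \<kappa> \<le> 1 \<and> 8 * \<kappa> powr ((1 + \<beta>/2) / (1 + \<beta>)) \<le> 1 \<and>
    exp 2 * (4 / \<kappa>) * 2 powr (a + 1) * (8 * \<kappa> powr ((1 + \<beta>/2) / (1 + \<beta>))) powr (1 + \<beta>) \<le> 1/2"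
proof -
  define K :: real where "K = exp 2 * 4 * 2 powr (a + 1) * 8 powr (1 + \<beta>)"
  define \<gamma> where "\<gamma> = (1 + \<beta>/2) / (1 + \<beta>)"
  have g: "\<gamma> > 0" "\<gamma> * (1 + \<beta>) = 1 + \<beta>/2" unfolding \<gamma>_def using assms by auto
  have "\<forall>\<^sub>F \<kappa>::real in at_right 0. 0 < \<kappa>" "\<forall>\<^sub>F \<kappa>::real in at_right 0. \<kappa> \<le> 1"
    by real_asymp+
  moreover have "\<forall>\<^sub>F \<kappa>::real in at_right 0. 8 * \<kappa> powr \<gamma> \<le> 1" using g by real_asymp
  moreover have "\<forall>\<^sub>F \<kappa>::real in at_right 0. K * \<kappa> powr (\<beta>/2) \<le> 1/2" using assms by real_asymp
  ultimately show ?thesis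
    unfolding \<gamma>_def[symmetric]
  proof eventually_elim
    case (elim \<kappa>)
    have "(8 * \<kappa> powr \<gamma>) powr (1 + \<beta>) = 8 powr (1 + \<beta>) * \<kappa> powr (1 + \<beta>/2)"
      by (simp add: powr_mult powr_powr g)
    also have "\<kappa> powr (1 + \<beta>/2) = \<kappa> * \<kappa> powr (\<beta>/2)"
      using elim by (simp add: powr_add)
    finally have "exp 2 * (4 / \<kappa>) * 2 powr (a + 1) * (8 * \<kappa> powr \<gamma>) powr (1 + \<beta>) = K * \<kappa> powr (\<beta>/2)"
      unfolding K_def using elim by simp
    then show ?case using elim by simp
  qed
qed

context heavy_tail
begin

text \<open>The exceptional set is quantified before v: the event that some bottom singular vector
  is spread is not evidently measurable, so it is only covered by a measurable set.\<close>

lemma bottom_vector_not_spread: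
  fixes a \<epsilon> \<delta> \<theta> :: real
  assumes a: "a > 1" and pos: "\<epsilon> > 0" "\<delta> > 0" "\<theta> > 0"
  shows "\<exists>n0. \<forall>n\<ge>n0. \<forall>M X N. iid_matrix (M :: 'w measure) \<mu> N n X \<longrightarrow> a * n \<le> N \<longrightarrow> N \<le> (a + 1) * n \<longrightarrow>
    (\<exists>B\<in>sets M. measure M B \<le> \<theta> \<and> (\<forall>\<omega>\<in>space M - B. \<forall>v. bottom_singular_vector N n (\<lambda>i j. X i j \<omega>) v \<longrightarrow>
      card {j\<in>{1..n}. sqrt (\<delta> / n) \<le> \<bar>v j\<bar>} \<le> \<epsilon> * n))"
proof -
  \<comment> \<open>After three losses of tau N rows, at least (1 - 3 tau) a n = (1 + beta) n
    remain: half of the excess a - 1 is kept.\<close>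
  define \<tau> where "\<tau> = (a - 1) / (6 * a)"
  define \<beta> where "\<beta> = (a - 1) / 2"
  define \<gamma> where "\<gamma> = (1 + \<beta>/2) / (1 + \<beta>)"
  \<comment> \<open>Chosen so that the expected number of entries above R L is at most theta/4 times
    tau N, ready for Markov.\<close>
  define R where "R = (4 * C / (\<tau> * \<theta>)) powr (1/\<alpha>)"
  \<comment> \<open>Likewise, F n L^2 is 4 / theta times an upper bound for the expected truncated
    Frobenius square when N <= (a + 1) n.\<close>
  define F where "F = 4 * (a + 1) * moment_const * R powr (2 - \<alpha>) / \<theta>"
  \<comment> \<open>No kappa occurs here, so \<open>small_ball\<close> can be applied with this
    threshold and kappa chosen afterwards.\<close>
  define H where "H = (1 + sqrt F) / sqrt \<tau>"
  define b where "b = sqrt \<delta> / 2"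
  define D where "D = sqrt (2 / \<epsilon>) + 1"
  have \<beta>: "\<beta> > 0" and \<tau>: "\<tau> > 0" "3 * \<tau> < 1" "(1 - 3 * \<tau>) * a = 1 + \<beta>"
    unfolding \<tau>_def \<beta>_def using a by (auto simp: field_simps)
  have R: "R > 0" unfolding R_def using C_pos \<tau> pos by simp
  have CR: "C * R powr (-\<alpha>) = \<tau> * \<theta> / 4"
    unfolding R_def using C_pos \<tau> pos alpha_pos by (simp add: powr_powr powr_minus)
  have F: "F > 0" unfolding F_def using a moment_const_pos R pos by simp
  have H: "H > 0" unfolding H_def using \<tau> F by (simp add: add_pos_pos)
  have bD: "b > 0" "D > 0" unfolding b_def D_def using pos by (auto simp: add_nonneg_pos)
  have \<gamma>: "0 < \<gamma>" "\<gamma> < 1" unfolding \<gamma>_def using \<beta> by (auto simp: field_simps)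
  have "\<epsilon> / 2 > 0" using pos by simp
  from small_ball[where ?'w = 'w, OF this bD H \<gamma>]
  have "\<forall>\<^sub>F \<kappa> in at_right 0. \<exists>n0. \<forall>n\<ge>n0. \<forall>M Y z. prob_space (M :: 'w measure) \<longrightarrow>
      prob_space.indep_vars M (\<lambda>_. borel) Y {1..n} \<longrightarrow> (\<forall>j\<in>{1..n}. distr M borel (Y j) = \<mu>) \<longrightarrow>
      \<epsilon> / 2 * real n \<le> card {j\<in>{1..n}. b / \<kappa> \<le> \<bar>z j\<bar> \<and> \<bar>z j\<bar> \<le> D / \<kappa>} \<longrightarrow>
      measure M {\<omega>\<in>space M. \<bar>\<Sum>j\<in>{1..n}. Y j \<omega> * z j\<bar> \<le> H * real n powr (1/\<alpha>)} \<le> 8 * \<kappa> powr \<gamma>" .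
  moreover have "\<forall>\<^sub>F \<kappa> in at_right 0. \<kappa> < b"
    using bD by (simp add: eventually_at_right_less eventually_at_right[of 0 1]) (meson dense_le_bounded less_trans)
  moreover note exists_base_small[OF \<beta>, of a, folded \<gamma>_def]
  ultimately have "\<forall>\<^sub>F \<kappa> in at_right 0. (0 < \<kappa> \<and> \<kappa> \<le> 1 \<and> \<kappa> < b \<and> 8 * \<kappa> powr \<gamma> \<le> 1 \<and>
      exp 2 * (4 / \<kappa>) * 2 powr (a + 1) * (8 * \<kappa> powr \<gamma>) powr (1 + \<beta>) \<le> 1/2) \<and>
     (\<exists>n0. \<forall>n\<ge>n0. \<forall>M Y z. prob_space (M :: 'w measure) \<longrightarrow>
      prob_space.indep_vars M (\<lambda>_. borel) Y {1..n} \<longrightarrow> (\<forall>j\<in>{1..n}. distr M borel (Y j) = \<mu>) \<longrightarrow>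
      \<epsilon> / 2 * real n \<le> card {j\<in>{1..n}. b / \<kappa> \<le> \<bar>z j\<bar> \<and> \<bar>z j\<bar> \<le> D / \<kappa>} \<longrightarrow>
      measure M {\<omega>\<in>space M. \<bar>\<Sum>j\<in>{1..n}. Y j \<omega> * z j\<bar> \<le> H * real n powr (1/\<alpha>)} \<le> 8 * \<kappa> powr \<gamma>)"
    by eventually_elim (intro conjI; blast)
  from eventually_happens'[OF trivial_limit_at_right_real this]
  obtain \<kappa> n0 where \<kappa>: "0 < \<kappa>" "\<kappa> \<le> 1" "\<kappa> < b" "8 * \<kappa> powr \<gamma> \<le> 1"
      "exp 2 * (4 / \<kappa>) * 2 powr (a + 1) * (8 * \<kappa> powr \<gamma>) powr (1 + \<beta>) \<le> 1/2"
    and n0: "\<And>n M Y z. n0 \<le> n \<Longrightarrow> prob_space (M :: 'w measure) \<Longrightarrow>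
      prob_space.indep_vars M (\<lambda>_. borel) Y {1..n} \<Longrightarrow> (\<forall>j\<in>{1..n}. distr M borel (Y j) = \<mu>) \<Longrightarrow>
      \<epsilon> / 2 * real n \<le> card {j\<in>{1..n}. b / \<kappa> \<le> \<bar>z j\<bar> \<and> \<bar>z j\<bar> \<le> D / \<kappa>} \<Longrightarrow>
      measure M {\<omega>\<in>space M. \<bar>\<Sum>j\<in>{1..n}. Y j \<omega> * z j\<bar> \<le> H * real n powr (1/\<alpha>)} \<le> 8 * \<kappa> powr \<gamma>"
    by blast
  have "a + 1 > 0" "\<theta> / 4 > 0" using a pos by auto
  from some_column_small[where ?'w = 'w, OF \<kappa>(1) this]
  obtain n1 where n1: "\<And>n M X N. n1 \<le> n \<Longrightarrow> iid_matrix (M :: 'w measure) \<mu> N n X \<Longrightarrow> real N \<le> (a + 1) * real n \<Longrightarrow>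
    measure M {\<omega>\<in>space M. \<forall>j\<in>{1..n}. (\<Sum>i\<in>{1..N}. (X i j \<omega>)\<^sup>2) > (\<kappa> * real n powr (1/\<alpha>))\<^sup>2} \<le> \<theta> / 4"
    by blast
  have "(\<lambda>n. (1/2::real) ^ n) \<longlonglongrightarrow> 0" by (intro LIMSEQ_realpow_zero) auto
  then have "\<forall>\<^sub>F n in sequentially. (1/2::real) ^ n < \<theta> / 4" using pos by (intro order_tendstoD) auto
  then obtain n2 where n2: "\<And>n. n \<ge> n2 \<Longrightarrow> (1/2) ^ n < \<theta> / 4" by (auto simp: eventually_sequentially)
  have "\<exists>B\<in>sets M. measure M B \<le> \<theta> \<and> (\<forall>\<omega>\<in>space M - B. \<forall>v. bottom_singular_vector N n (\<lambda>i j. X i j \<omega>) v \<longrightarrow>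
      card {j\<in>{1..n}. sqrt (\<delta> / n) \<le> \<bar>v j\<bar>} \<le> \<epsilon> * n)"
    if n: "Max {1, n0, n1, n2} \<le> n" and iid: "iid_matrix M \<mu> N n X" and N: "a * n \<le> N" "N \<le> (a + 1) * n"
    for n N and M :: "'w measure" and X
  proof -
    interpret M: prob_space M using iid unfolding iid_matrix_def by simp
    note [measurable] = iid_matrix_measurable[OF iid]
    have distr: "\<And>i j. i \<in> {1..N} \<Longrightarrow> j \<in> {1..n} \<Longrightarrow> distr M borel (X i j) = \<mu>"
      using iid unfolding iid_matrix_def by auto
    have ns: "n \<ge> 1" "n \<ge> n0" "n \<ge> n1" "n \<ge> n2" using n by auto
    have "1 * real n \<le> a * n" using a by (intro mult_right_mono) auto
    then have nN: "n \<le> N" using N by linarith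
    define L where "L = real n powr (1/\<alpha>)"
    have L: "L > 0" unfolding L_def using ns by simp
    have L\<alpha>: "L powr \<alpha> = n" unfolding L_def using ns alpha_pos by (simp add: powr_powr)
    define T where "T = R * L"
    have T: "T > 0" unfolding T_def using R L by simp
    define m where "m = nat \<lceil>(1 - 3 * \<tau>) * N\<rceil>"
    let ?Q = "\<lambda>z :: nat \<Rightarrow> int. \<epsilon> / 2 * n \<le>
      card {j\<in>{1..n}. b / \<kappa> \<le> \<bar>real_of_int (z j)\<bar> \<and> \<bar>real_of_int (z j)\<bar> \<le> D / \<kappa>}"
    \<comment> \<open>Four failures share the budget theta equally: no short column, a large
      truncated Frobenius norm, too many large entries, and a spread lattice point with too many
      small rows.\<close>
    define B1 where "B1 = {\<omega>\<in>space M. \<forall>j\<in>{1..n}. (\<Sum>i\<in>{1..N}. (X i j \<omega>)\<^sup>2) > (\<kappa> * L)\<^sup>2}"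
    define B2 where "B2 = {\<omega>\<in>space M. (\<Sum>i\<in>{1..N}. \<Sum>j\<in>{1..n}. min ((X i j \<omega>)\<^sup>2) (T\<^sup>2)) > F * n * L\<^sup>2}"
    define B3 where "B3 = {\<omega>\<in>space M. (\<Sum>i\<in>{1..N}. \<Sum>j\<in>{1..n}. indicator {x. \<bar>x\<bar> > T} (X i j \<omega>)) > \<tau> * N}"
    define B4 where "B4 = {\<omega>\<in>space M. \<exists>z\<in>int_l1_ball n (2 * real n / \<kappa>). ?Q z \<and>
      m \<le> card {i\<in>{1..N}. \<bar>\<Sum>j\<in>{1..n}. X i j \<omega> * real_of_int (z j)\<bar> \<le> H * L}}"
    have P1: "M.prob B1 \<le> \<theta> / 4" unfolding B1_def L_def by (rule n1) (use ns iid N in auto)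
    have P2: "M.prob B2 \<le> \<theta> / 4"
      unfolding B2_def
    proof (rule iid_matrix_sum_markov[OF iid, where K = "T\<^sup>2"])
      have "real N * real n * expectation (\<lambda>x. min (x\<^sup>2) (T\<^sup>2)) \<le> ((a + 1) * real n) * real n * (moment_const * T powr (2 - \<alpha>))"
        using N a truncated_second_moment[OF T] moment_const_pos
        by (intro mult_mono) (auto intro!: mult_right_mono)
      also have "T powr (2 - \<alpha>) = R powr (2 - \<alpha>) * (L\<^sup>2 / n)"
      proof -
        have "T powr (2 - \<alpha>) = R powr (2 - \<alpha>) * L powr (2 - \<alpha>)" unfolding T_def by (rule powr_mult)
        also have "L powr (2 - \<alpha>) = L\<^sup>2 / n" using L L\<alpha> by (simp add: powr_diff)
        finally show ?thesis .
      qed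
      also have "((a + 1) * real n) * real n * (moment_const * (R powr (2 - \<alpha>) * (L\<^sup>2 / n))) = \<theta> / 4 * (F * n * L\<^sup>2)"
        unfolding F_def using ns pos by (simp add: field_simps)
      finally show "real N * real n * expectation (\<lambda>x. min (x\<^sup>2) (T\<^sup>2)) \<le> \<theta> / 4 * (F * n * L\<^sup>2)" .
    qed (use F L ns in auto)
    have P3: "M.prob B3 \<le> \<theta> / 4"
      unfolding B3_def
    proof (rule iid_matrix_sum_markov[OF iid, where K = 1])
      have "expectation (indicator {x. \<bar>x\<bar> > T}) = prob {x. \<bar>x\<bar> > T}" by simp
      also have "\<dots> \<le> C * T powr (-\<alpha>)" by (rule tail_upper[OF T])
      also have "T powr (-\<alpha>) = R powr (-\<alpha>) * L powr (-\<alpha>)" unfolding T_def by (rule powr_mult)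
      also have "L powr (-\<alpha>) = 1 / n" using L\<alpha> by (simp add: powr_minus divide_inverse)
      also have "C * (R powr (-\<alpha>) * (1 / n)) = \<tau> * \<theta> / 4 / n"
        by (simp only: CR[symmetric] times_divide_eq_right mult_1_right)
      finally have "real N * real n * expectation (indicator {x. \<bar>x\<bar> > T}) \<le> real N * real n * (\<tau> * \<theta> / 4 / n)"
        by (intro mult_left_mono) auto
      then show "real N * real n * expectation (indicator {x. \<bar>x\<bar> > T}) \<le> \<theta> / 4 * (\<tau> * N)"
        using ns by (simp add: field_simps)
    qed (use \<tau> nN ns in \<open>auto split: split_indicator\<close>)
    have m: "(1 + \<beta>) * n \<le> m"
    proof -
      have "(1 + \<beta>) * n = (1 - 3 * \<tau>) * (a * n)" using \<tau> by simp
      also have "\<dots> \<le> (1 - 3 * \<tau>) * N" using N \<tau> by (intro mult_left_mono) auto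
      finally show ?thesis unfolding m_def by linarith
    qed
    have rows: "M.prob {\<omega>\<in>space M. \<bar>\<Sum>j\<in>{1..n}. X i j \<omega> * real_of_int (z j)\<bar> \<le> H * L} \<le> 8 * \<kappa> powr \<gamma>"
      if "?Q z" "i \<in> {1..N}" for z i
      unfolding L_def by (rule n0[OF ns(2) M.prob_space_axioms iid_matrix_row_sums(2)[OF iid that(2)]])
        (use distr that in auto)
    have "0 < 8 * \<kappa> powr \<gamma>" using \<kappa> by simp
    note union = lattice_union_bound[OF iid ns(1) N(2) m \<kappa>(1,2) this \<kappa>(4,5), of ?Q "H * L", OF rows]
    have B4: "B4 \<in> sets M" unfolding B4_def by (rule union(1))
    have "M.prob B4 \<le> (1/2) ^ n" unfolding B4_def by (rule union(2))
    then have P4: "M.prob B4 \<le> \<theta> / 4" using n2[OF ns(4)] by linarith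
    have [measurable]: "B1 \<in> sets M" "B2 \<in> sets M" "B3 \<in> sets M"
      unfolding B1_def B2_def B3_def by measurable
    show ?thesis
    proof (intro bexI conjI ballI allI impI)
      show sets: "B1 \<union> B2 \<union> B3 \<union> B4 \<in> sets M" using B4 by auto
      have "M.prob (B1 \<union> B2 \<union> B3 \<union> B4) \<le> M.prob B1 + M.prob B2 + M.prob B3 + M.prob B4"
        using B4 measure_Un_le[of "B1 \<union> B2 \<union> B3" M B4]
          measure_Un_le[of "B1 \<union> B2" M B3] measure_Un_le[of B1 M B2] by simp
      then show "M.prob (B1 \<union> B2 \<union> B3 \<union> B4) \<le> \<theta>" using P1 P2 P3 P4 by linarith
      fix \<omega> v assume \<omega>: "\<omega> \<in> space M - (B1 \<union> B2 \<union> B3 \<union> B4)"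
        and v: "bottom_singular_vector N n (\<lambda>i j. X i j \<omega>) v"
      show "card {j\<in>{1..n}. sqrt (\<delta> / n) \<le> \<bar>v j\<bar>} \<le> \<epsilon> * n"
      proof (rule ccontr)
        assume "\<not> ?thesis"
        then have sp: "\<epsilon> * n < card {j\<in>{1..n}. sqrt (\<delta> / n) \<le> \<bar>v j\<bar>}" by simp
        have "\<exists>z\<in>int_l1_ball n (2 * real n / \<kappa>). ?Q z \<and>
          (1 - 3 * \<tau>) * N \<le> card {i\<in>{1..N}. \<bar>\<Sum>j\<in>{1..n}. X i j \<omega> * real_of_int (z j)\<bar> \<le> H * L}"
          unfolding H_def b_def D_def
          by (rule spread_bottom_vector_imp_lattice_point[OF ns(1) nN pos(1,2) \<kappa>(1,2) _ L F \<tau>(1) v sp, where T = T])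
             (use \<kappa> \<omega> in \<open>auto simp: b_def B1_def B2_def B3_def not_less\<close>)
        then have "\<omega> \<in> B4" using \<omega> unfolding B4_def m_def by (auto simp: nat_le_iff ceiling_le_iff)
        then show False using \<omega> by blast
      qed
    qed
  qed
  then show ?thesis by blast
qed

end

section \<open>Letting the proportion tend to zero, and selecting the coordinates\<close>

lemma diagonal_null_sequence:
  fixes f :: "nat \<Rightarrow> nat \<Rightarrow> real"
  assumes "\<And>k. \<forall>\<^sub>F n in sequentially. f k n \<le> 1 / Suc k"
  shows "\<exists>s. filterlim s at_top sequentially \<and> (\<forall>\<^sub>F n in sequentially. f (s n) n \<le> 1 / Suc (s n))"
proof -
  obtain t where t: "\<And>k n. n \<ge> t k \<Longrightarrow> f k n \<le> 1 / Suc k"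
    using assms unfolding eventually_sequentially by metis
  \<comment> \<open>This is the largest index all of whose thresholds n has passed. The cap k <= n
    makes the set finite, and the exemption of l = 0 makes it nonempty, so that \<open>Max\<close>
    is meaningful; the condition n >= t 0 at the end compensates for the exemption.\<close>
  define s where "s n = Max {k. k \<le> n \<and> (\<forall>l\<le>k. l = 0 \<or> t l \<le> n)}" for n
  have fin: "finite {k. k \<le> n \<and> (\<forall>l\<le>k. l = 0 \<or> t l \<le> n)}" for n by simp
  have "s n \<in> {k. k \<le> n \<and> (\<forall>l\<le>k. l = 0 \<or> t l \<le> n)}" for n
    unfolding s_def using fin by (rule Max_in) auto
  then have s: "s n = 0 \<or> t (s n) \<le> n" for n by blast
  have "filterlim s at_top sequentially"
    unfolding filterlim_at_top
  proof
    fix k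
    have "k \<le> s n" if n: "n \<ge> max k (Max (t ` {..k}))" for n
    proof -
      have "t l \<le> n" if "l \<le> k" for l
        using n that Max_ge[of "t ` {..k}" "t l"] by fastforce
      then have "k \<in> {k. k \<le> n \<and> (\<forall>l\<le>k. l = 0 \<or> t l \<le> n)}" using n by auto
      then show ?thesis unfolding s_def using fin by (rule Max_ge[rotated])
    qed
    then show "\<forall>\<^sub>F n in sequentially. k \<le> s n" unfolding eventually_sequentially by blast
  qed
  moreover have "\<forall>\<^sub>F n in sequentially. f (s n) n \<le> 1 / Suc (s n)"
    using eventually_ge_at_top[of "t 0"] by eventually_elim (use s t in metis)
  ultimately show ?thesis by blast
qed

text \<open>The fallback to all coordinates makes the cardinality bound hold for every v, so that
  only the norm bound is left to hold with high probability.\<close>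

definition small_coordinates :: "nat \<Rightarrow> real \<Rightarrow> nat \<Rightarrow> (nat \<Rightarrow> real) \<Rightarrow> nat set" where
  "small_coordinates n t r v =
    (if card {j\<in>{1..n}. t \<le> \<bar>v j\<bar>} \<le> r then {j\<in>{1..n}. \<bar>v j\<bar> < t} else {1..n})"

lemma small_coordinates_subset: "small_coordinates n t r v \<subseteq> {1..n}"
  unfolding small_coordinates_def by auto

lemma card_small_coordinates: "n \<le> card (small_coordinates n t r v) + r"
proof (cases "card {j\<in>{1..n}. t \<le> \<bar>v j\<bar>} \<le> r")
  case True
  have "{1..n} = {j\<in>{1..n}. \<bar>v j\<bar> < t} \<union> {j\<in>{1..n}. t \<le> \<bar>v j\<bar>}" by auto
  then have "n \<le> card {j\<in>{1..n}. \<bar>v j\<bar> < t} + card {j\<in>{1..n}. t \<le> \<bar>v j\<bar>}"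
    by (metis card_Un_le card_atLeastAtMost diff_Suc_1)
  then show ?thesis using True unfolding small_coordinates_def by simp
qed (auto simp: small_coordinates_def)

text \<open>The target is finite, so preimages of single sets suffice, and each of these is decided
  by finitely many comparisons of |v j| with t.\<close>

lemma small_coordinates_measurable:
  "small_coordinates n t r \<in> measurable (Pi\<^sub>M {1..n} (\<lambda>_. borel)) (count_space (Pow {1..n}))"
proof -
  let ?P = "Pi\<^sub>M {1..n} (\<lambda>_. borel :: real measure)"
  have [measurable]: "(\<lambda>v. v j) \<in> borel_measurable ?P" if "j \<in> {1..n}" for j
    using that by (rule measurable_component_singleton)
  have lt [measurable]: "{v\<in>space ?P. (\<bar>v j\<bar> < t) = c} \<in> sets ?P" if "j \<in> {1..n}" for j c
    using that by measurable
  have card: "{v\<in>space ?P. card {j\<in>{1..n}. t \<le> \<bar>v j\<bar>} \<le> r} \<in> sets ?P"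
  proof -
    have "card {j\<in>{1..n}. t \<le> \<bar>v j\<bar>} = (\<Sum>j\<in>{1..n}. if t \<le> \<bar>v j\<bar> then 1 else 0)" for v :: "nat \<Rightarrow> real"
      by (simp add: sum.If_cases Int_def)
    then show ?thesis by simp
  qed
  show ?thesis
  proof (rule measurable_count_space_eq2[THEN iffD2])
    show "finite (Pow {1..n})" by simp
    show "small_coordinates n t r \<in> space ?P \<rightarrow> Pow {1..n} \<and>
      (\<forall>S\<in>Pow {1..n}. small_coordinates n t r -` {S} \<inter> space ?P \<in> sets ?P)"
    proof (intro conjI ballI funcsetI)
      fix v show "small_coordinates n t r v \<in> Pow {1..n}" using small_coordinates_subset by blast
    next
      fix S assume S: "S \<in> Pow {1..n}"
      have "small_coordinates n t r -` {S} \<inter> space ?P =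
          ({v\<in>space ?P. card {j\<in>{1..n}. t \<le> \<bar>v j\<bar>} \<le> r} \<inter>
            {v\<in>space ?P. \<forall>j\<in>{1..n}. (\<bar>v j\<bar> < t) = (j \<in> S)}) \<union>
          ((space ?P - {v\<in>space ?P. card {j\<in>{1..n}. t \<le> \<bar>v j\<bar>} \<le> r}) \<inter> {v\<in>space ?P. {1..n} = S})"
      proof -
        have "{j\<in>{1..n}. \<bar>v j\<bar> < t} = S \<longleftrightarrow> (\<forall>j\<in>{1..n}. (\<bar>v j\<bar> < t) = (j \<in> S))" for v :: "nat \<Rightarrow> real"
          using S by blast
        then have iff: "small_coordinates n t r v = S \<longleftrightarrow>
            (if card {j\<in>{1..n}. t \<le> \<bar>v j\<bar>} \<le> r then \<forall>j\<in>{1..n}. (\<bar>v j\<bar> < t) = (j \<in> S) else {1..n} = S)" for v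
          unfolding small_coordinates_def by presburger
        have vimage_if: "f -` {S} \<inter> Y = ({v\<in>Y. P v} \<inter> {v\<in>Y. Q v}) \<union> ((Y - {v\<in>Y. P v}) \<inter> {v\<in>Y. R})"
          if "\<And>v. f v = S \<longleftrightarrow> (if P v then Q v else R)" for f :: "(nat \<Rightarrow> real) \<Rightarrow> nat set" and Y P Q R
          by (intro set_eqI, unfold vimage_singleton_eq Int_iff Un_iff Diff_iff mem_Collect_eq that) argo
        show ?thesis by (rule vimage_if) (rule iff)
      qed
      also have "\<dots> \<in> sets ?P"
        using card lt by (intro sets.Un sets.Int sets.Diff sets.top sets.sets_Collect_finite_All sets.sets_Collect_const) auto
      finally show "small_coordinates n t r -` {S} \<inter> space ?P \<in> sets ?P" .
    qed
  qed
qed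

lemma L2_set_small_coordinates:
  assumes n: "n \<ge> 1" and \<delta>: "\<delta> > 0" and c: "card {j\<in>{1..n}. sqrt (\<delta> / n) \<le> \<bar>v j\<bar>} \<le> r"
  shows "L2_set v (small_coordinates n (sqrt (\<delta> / n)) r v) < sqrt \<delta>"
proof -
  let ?J = "{j\<in>{1..n}. \<bar>v j\<bar> < sqrt (\<delta> / n)}"
  have sq: "(v j)\<^sup>2 < \<delta> / n" if "j \<in> ?J" for j
  proof -
    have "\<bar>v j\<bar>\<^sup>2 < (sqrt (\<delta> / n))\<^sup>2" using that by (intro power_strict_mono) auto
    then show ?thesis using \<delta> by simp
  qed
  have "(\<Sum>j\<in>?J. (v j)\<^sup>2) < \<delta>"
  \<comment> \<open>Strict monotonicity of sums needs a nonempty index set.\<close>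
  proof (cases "?J = {}")
    case False
    have "(\<Sum>j\<in>?J. (v j)\<^sup>2) < (\<Sum>j\<in>?J. \<delta> / n)" using False sq by (intro sum_strict_mono) auto
    also have "\<dots> \<le> (\<Sum>j\<in>{1..n}. \<delta> / n)" using \<delta> by (intro sum_mono2) auto
    finally show ?thesis using n by simp
  qed (use \<delta> in \<open>simp only: sum.empty\<close>)
  then show ?thesis using c unfolding small_coordinates_def L2_set_def by simp
qed

theorem corollary1p7:
  fixes a \<alpha> :: real
    and \<mu> :: "real measure"
    and N :: "nat \<Rightarrow> nat"
    and M :: "nat \<Rightarrow> 'w measure"
    and X :: "nat \<Rightarrow> nat \<Rightarrow> nat \<Rightarrow> 'w \<Rightarrow> real"
    and u :: "nat \<Rightarrow> 'w \<Rightarrow> nat \<Rightarrow> real"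
  assumes "a > 1"
    and "0 < \<alpha>" and "\<alpha> < 2"
    and "heavy_tailed_law \<mu> \<alpha>"
    and "symmetric_law \<mu>"
    and "\<And>n. N n = nat \<lceil>a * real n\<rceil>"
    and "\<And>n. n \<ge> 1 \<Longrightarrow> iid_matrix (M n) \<mu> (N n) n (X n)"
    and "\<And>n. n \<ge> 1 \<Longrightarrow> u n \<in> measurable (M n) (Pi\<^sub>M {1..n} (\<lambda>_. borel))"
    and "\<And>n \<omega>. n \<ge> 1 \<Longrightarrow> \<omega> \<in> space (M n) \<Longrightarrow>
           bottom_singular_vector (N n) n (\<lambda>i j. X n i j \<omega>) (u n \<omega>)"
  shows "\<forall>\<delta>>0. \<exists>(J :: nat \<Rightarrow> (nat \<Rightarrow> real) \<Rightarrow> nat set) (r :: nat \<Rightarrow> nat).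
           (\<forall>n. J n \<in> measurable (Pi\<^sub>M {1..n} (\<lambda>_. borel)) (count_space (Pow {1..n}))) \<and>
           (\<lambda>n. real (r n)) \<in> o(\<lambda>n. real n) \<and>
           (\<forall>n. \<forall>v\<in>space (Pi\<^sub>M {1..n} (\<lambda>_. borel :: real measure)). n \<le> card (J n v) + r n) \<and>
           (\<lambda>n. measure (M n) {\<omega> \<in> space (M n). L2_set (u n \<omega>) (J n (u n \<omega>)) < sqrt \<delta>})
             \<longlonglongrightarrow> 1"
proof (intro allI impI)
  fix \<delta> :: real assume \<delta>: "\<delta> > 0"
  obtain C Cl T0 where "heavy_tail \<mu> \<alpha> C Cl T0"
    using heavy_tailed_law_imp_heavy_tail[OF assms(4,5,2,3)] by blast
  then interpret H: heavy_tail \<mu> \<alpha> C Cl T0 .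
  \<comment> \<open>The index k stands for the proportion 1 / (k + 1) of discarded coordinates; it
    is replaced by a slowly growing \<open>s n\<close> at the end.\<close>
  define J where "J k n = small_coordinates n (sqrt (\<delta> / n)) (nat \<lfloor>n / real (Suc k)\<rfloor>)" for k n :: nat
  define G where "G k n = {\<omega> \<in> space (M n). L2_set (u n \<omega>) (J k n (u n \<omega>)) < sqrt \<delta>}" for k n
  have M: "prob_space (M n)" if "n \<ge> 1" for n
    using assms(7)[OF that] unfolding iid_matrix_def by simp
  have meas: "G k n \<in> sets (M n)" if n: "n \<ge> 1" for k n
  proof -
    note u [measurable] = assms(8)[OF n]
    have comp [measurable]: "(\<lambda>\<omega>. u n \<omega> j) \<in> borel_measurable (M n)" if "j \<in> {1..n}" for j
      using measurable_component_singleton[OF that] u by (rule measurable_compose[rotated])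
    have "(\<lambda>\<omega>. J k n (u n \<omega>)) \<in> measurable (M n) (count_space (Pow {1..n}))"
      unfolding J_def by (rule measurable_compose[OF u small_coordinates_measurable])
    then have JS: "{\<omega>\<in>space (M n). J k n (u n \<omega>) = S} \<in> sets (M n)" if "S \<in> Pow {1..n}" for S
      using that measurable_sets[of _ "M n" "count_space (Pow {1..n})" "{S}"]
      by (simp add: vimage_def Int_def conj_commute)
    have "{\<omega>\<in>space (M n). L2_set (u n \<omega>) S < sqrt \<delta>} \<in> sets (M n)" if "S \<in> Pow {1..n}" for S
    proof -
      have [measurable]: "(\<lambda>\<omega>. u n \<omega> j) \<in> borel_measurable (M n)" if "j \<in> S" for j
        using comp that \<open>S \<in> Pow {1..n}\<close> by blast
      show ?thesis unfolding L2_set_def by measurable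
    qed
    \<comment> \<open>Splitting by the finitely many values of the random set reduces measurability
      to norms over fixed sets.\<close>
    then have "(\<Union>S\<in>Pow {1..n}. {\<omega>\<in>space (M n). J k n (u n \<omega>) = S} \<inter> {\<omega>\<in>space (M n). L2_set (u n \<omega>) S < sqrt \<delta>}) \<in> sets (M n)"
      using JS by (intro sets.finite_UN sets.Int) auto
    also have "(\<Union>S\<in>Pow {1..n}. {\<omega>\<in>space (M n). J k n (u n \<omega>) = S} \<inter> {\<omega>\<in>space (M n). L2_set (u n \<omega>) S < sqrt \<delta>}) = G k n"
      unfolding G_def J_def using small_coordinates_subset by fastforce
    finally show ?thesis .
  qed
  have "\<forall>\<^sub>F n in sequentially. 1 - measure (M n) (G k n) \<le> 1 / Suc k" for k
  proof -
    have pos: "1 / real (Suc k) > 0" by simp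
    obtain n0 where n0: "\<And>n M X N. n \<ge> n0 \<Longrightarrow> iid_matrix (M :: 'w measure) \<mu> N n X \<Longrightarrow> a * n \<le> N \<Longrightarrow> N \<le> (a + 1) * n \<Longrightarrow>
      (\<exists>B\<in>sets M. measure M B \<le> 1 / real (Suc k) \<and> (\<forall>\<omega>\<in>space M - B. \<forall>v. bottom_singular_vector N n (\<lambda>i j. X i j \<omega>) v \<longrightarrow>
        card {j\<in>{1..n}. sqrt (\<delta> / n) \<le> \<bar>v j\<bar>} \<le> 1 / real (Suc k) * n))"
      \<comment> \<open>The same number is both the proportion and the failure probability, so one
        diagonal index drives both to zero.\<close>
      using H.bottom_vector_not_spread[where ?'w = 'w, OF assms(1) pos \<delta> pos] by blast
    have "1 - measure (M n) (G k n) \<le> 1 / Suc k" if n: "n \<ge> max 1 n0" for n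
    proof -
      have n1: "n \<ge> 1" and nn: "n \<ge> n0" using n by auto
      interpret M: prob_space "M n" by (rule M[OF n1])
      have "a * n \<le> N n" using assms(6)[of n] by linarith
      moreover have "N n \<le> (a + 1) * n"
      proof -
        have "0 \<le> a * n" using assms(1) by simp
        then have "real (N n) \<le> a * n + 1" using assms(6)[of n] by linarith
        \<comment> \<open>The condition n >= 1 absorbs the rounding in the number of rows.\<close>
        also have "\<dots> \<le> a * n + n" using n1 by simp
        finally show ?thesis by (simp add: algebra_simps)
      qed
      ultimately obtain B where B: "B \<in> sets (M n)" "measure (M n) B \<le> 1 / real (Suc k)"
        "\<And>\<omega> v. \<omega> \<in> space (M n) - B \<Longrightarrow> bottom_singular_vector (N n) n (\<lambda>i j. X n i j \<omega>) v \<Longrightarrow>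
          card {j\<in>{1..n}. sqrt (\<delta> / n) \<le> \<bar>v j\<bar>} \<le> 1 / real (Suc k) * n"
        using n0[OF nn assms(7)[OF n1]] by blast
      have "space (M n) - G k n \<subseteq> B"
      proof
        fix \<omega> assume \<omega>: "\<omega> \<in> space (M n) - G k n"
        show "\<omega> \<in> B"
        proof (rule ccontr)
          assume "\<omega> \<notin> B"
          then have "card {j\<in>{1..n}. sqrt (\<delta> / n) \<le> \<bar>u n \<omega> j\<bar>} \<le> 1 / real (Suc k) * n"
            using \<omega> assms(9)[OF n1, of \<omega>] by (intro B(3)) auto
          \<comment> \<open>Cardinalities are integers, so rounding the bound down loses
            nothing.\<close>
          then have "card {j\<in>{1..n}. sqrt (\<delta> / n) \<le> \<bar>u n \<omega> j\<bar>} \<le> nat \<lfloor>n / real (Suc k)\<rfloor>"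
            by (simp add: le_nat_iff le_floor_iff)
          from L2_set_small_coordinates[OF n1 \<delta> this]
          show False using \<omega> unfolding G_def J_def by auto
        qed
      qed
      then have "M.prob (space (M n) - G k n) \<le> M.prob B" using B by (intro M.finite_measure_mono)
      then show ?thesis using B(2) M.prob_compl[OF meas[OF n1]] by simp
    qed
    then show ?thesis unfolding eventually_sequentially by blast
  qed
  then obtain s where s: "filterlim s at_top sequentially"
    and ev: "\<forall>\<^sub>F n in sequentially. 1 - measure (M n) (G (s n) n) \<le> 1 / Suc (s n)"
    using diagonal_null_sequence[of "\<lambda>k n. 1 - measure (M n) (G k n)"] by blast
  have s0: "(\<lambda>n. 1 / real (Suc (s n))) \<longlonglongrightarrow> 0"
    using filterlim_compose[OF LIMSEQ_inverse_real_of_nat s] by (simp add: divide_inverse)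
  show "\<exists>(J :: nat \<Rightarrow> (nat \<Rightarrow> real) \<Rightarrow> nat set) (r :: nat \<Rightarrow> nat).
           (\<forall>n. J n \<in> measurable (Pi\<^sub>M {1..n} (\<lambda>_. borel)) (count_space (Pow {1..n}))) \<and>
           (\<lambda>n. real (r n)) \<in> o(\<lambda>n. real n) \<and>
           (\<forall>n. \<forall>v\<in>space (Pi\<^sub>M {1..n} (\<lambda>_. borel :: real measure)). n \<le> card (J n v) + r n) \<and>
           (\<lambda>n. measure (M n) {\<omega> \<in> space (M n). L2_set (u n \<omega>) (J n (u n \<omega>)) < sqrt \<delta>})
             \<longlonglongrightarrow> 1"
  proof (intro exI[of _ "\<lambda>n. J (s n) n"] exI[of _ "\<lambda>n. nat \<lfloor>n / real (Suc (s n))\<rfloor>"] conjI allI ballI)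
    show "J (s n) n \<in> measurable (Pi\<^sub>M {1..n} (\<lambda>_. borel)) (count_space (Pow {1..n}))" for n
      unfolding J_def by (rule small_coordinates_measurable)
    show "n \<le> card (J (s n) n v) + nat \<lfloor>n / real (Suc (s n))\<rfloor>" for n v
      unfolding J_def by (rule card_small_coordinates)
    show "(\<lambda>n. real (nat \<lfloor>n / real (Suc (s n))\<rfloor>)) \<in> o(\<lambda>n. real n)"
    proof (rule smalloI_tendsto)
      show "(\<lambda>n. real (nat \<lfloor>n / real (Suc (s n))\<rfloor>) / real n) \<longlonglongrightarrow> 0"
      proof (rule tendsto_sandwich[OF _ _ tendsto_const s0])
        show "\<forall>\<^sub>F n in sequentially. 0 \<le> real (nat \<lfloor>n / real (Suc (s n))\<rfloor>) / real n" by simp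
        show "\<forall>\<^sub>F n in sequentially. real (nat \<lfloor>n / real (Suc (s n))\<rfloor>) / real n \<le> 1 / real (Suc (s n))"
          using eventually_ge_at_top[of 1]
        proof eventually_elim
          case (elim n)
          have "0 \<le> n / real (Suc (s n))" by simp
          then have "real (nat \<lfloor>n / real (Suc (s n))\<rfloor>) \<le> n / real (Suc (s n))" by linarith
          then have "real (nat \<lfloor>n / real (Suc (s n))\<rfloor>) / n \<le> n / real (Suc (s n)) / n"
            by (rule divide_right_mono) simp
          then show ?case using elim by simp
        qed
      qed
      show "\<forall>\<^sub>F n in sequentially. real n \<noteq> 0" using eventually_ge_at_top[of 1] by eventually_elim simp
    qed
    have "(\<lambda>n. measure (M n) (G (s n) n)) \<longlonglongrightarrow> 1"
    proof (rule tendsto_sandwich)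
      show "\<forall>\<^sub>F n in sequentially. 1 - 1 / real (Suc (s n)) \<le> measure (M n) (G (s n) n)"
        using ev by eventually_elim linarith
      show "\<forall>\<^sub>F n in sequentially. measure (M n) (G (s n) n) \<le> 1"
        using eventually_ge_at_top[of 1] by eventually_elim (use M prob_space.prob_le_1 in blast)
      show "(\<lambda>n. 1 - 1 / real (Suc (s n))) \<longlonglongrightarrow> 1" using tendsto_diff[OF tendsto_const s0, of 1] by simp
    qed simp
    then show "(\<lambda>n. measure (M n) {\<omega> \<in> space (M n). L2_set (u n \<omega>) (J (s n) n (u n \<omega>)) < sqrt \<delta>}) \<longlonglongrightarrow> 1"
      unfolding G_def .
  qed
qed

end
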